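(* Let $q$ be a prime power, $n\ge1$, and let $\alpha$ be a composition of $n$. Then the $P_\alpha$-fixed subalgebra of the quotient ring $Q=S/(x_1^{q},\dots,x_n^{q})$ has Hilbert series $$\mathrm{Hilb}(Q^{P_\alpha},t)=C_{\alpha,1}(t).$$
   Context: $S=\mathbb{F}_q[x_1,\dots,x_n]$ with the standard grading; $g=(g_{ij})\in GL_n(\mathbb{F}_q)$ acts on $S$ by $\mathbb{F}_q$-algebra automorphisms with $g(x_j)=\sum_i g_{ij}x_i$; this preserves the ideal $(x_1^q,\dots,x_n^q)$ and so descends to $Q$. A composition $\alpha=(\alpha_1,\dots,\alpha_\ell)$ of $n$ has positive integer parts summing to $n$; $P_\alpha\subset GL_n(\mathbb{F}_q)$ is the subgroup of block upper-triangular invertible matrices with diagonal blocks of sizes $\alpha_1,\dots,\alpha_\ell$. $\mathrm{Hilb}(U,t)=\sum_d\dim_{\mathbb{F}_q}(U_d)t^d$. For $m\ge0$, $$C_{\alpha,m}(t)=\sum_{\substack{\beta\le\alpha\\|\beta|\le m}}t^{\sum_{i=1}^\ell(\alpha_i-\beta_i)(q^m-q^{B_i})}\ \frac{\prod_{j=0}^{|\beta|-1}(1-t^{q^m-q^j})}{\prod_{i=1}^{\ell}\prod_{j=0}^{\beta_i-1}\bigl(1-t^{q^{B_i}-q^{B_{i-1}+j}}\bigr)},$$ the sum being over weak compositions $\beta=(\beta_1,\dots,\beta_\ell)$ (nonnegative integers) with $\beta_i\le\alpha_i$ for all $i$ and $|\beta|=\sum_i\beta_i\le m$, where $B_i=\beta_1+\cdots+\beta_i$,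 $B_0=0$, and empty products are $1$. *)

theory Defs
  imports
    "HOL-Algebra.QuotRing"
    "HOL-Algebra.Embedded_Algebras"
    "HOL-Algebra.Sylow"
    "HOL-Library.Poly_Mapping"
    "HOL-Library.Cardinality"
    "HOL-Computational_Algebra.Primes"
    "HOL-Computational_Algebra.Formal_Power_Series"
    "Jordan_Normal_Form.Matrix"
begin

text \<open>
  The finite field with \<open>q\<close> elements is a type \<open>'a :: finite_field\<close> with \<open>q = CARD('a)\<close>.
  Variables are numbered from 0: the index \<open>i < n\<close> stands for \<open>x\<^bsub>i+1\<^esub>\<close>.
  Compositions and weak compositions are lists of naturals, likewise indexed from 0.
\<close>

section \<open>The polynomial ring and its truncation\<close>

type_synonym 'a mpoly = "(nat \<Rightarrow>\<^sub>0 nat) \<Rightarrow>\<^sub>0 'a"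

definition mconst :: "'a::zero \<Rightarrow> 'a mpoly" where
  "mconst c = Poly_Mapping.single 0 c"

definition mvar :: "nat \<Rightarrow> 'a::zero_neq_one mpoly" where
  "mvar i = Poly_Mapping.single (Poly_Mapping.single i 1) 1"

definition polys :: "nat \<Rightarrow> 'a::zero mpoly set" where
  "polys n = {f. \<forall>m \<in> Poly_Mapping.keys f. Poly_Mapping.keys m \<subseteq> {..<n}}"

definition poly_ring :: "nat \<Rightarrow> 'a::comm_ring_1 mpoly ring" where
  "poly_ring n = \<lparr>carrier = polys n, monoid.mult = (*), one = 1, ring.zero = 0, add = (+)\<rparr>"

definition homogeneous :: "nat \<Rightarrow> nat \<Rightarrow> 'a::zero mpoly set" where
  "homogeneous n d =
     {f \<in> polys n. \<forall>m \<in> Poly_Mapping.keys f. (\<Sum>i<n. Poly_Mapping.lookup m i) = d}"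

definition frob_ideal :: "nat \<Rightarrow> 'a::finite_field mpoly set" where
  "frob_ideal n = Idl\<^bsub>poly_ring n\<^esub> ((\<lambda>i. mvar i ^ CARD('a)) ` {..<n})"

definition trunc_ring :: "nat \<Rightarrow> 'a::finite_field mpoly set ring" where
  "trunc_ring n = poly_ring n Quot frob_ideal n"

definition trunc_proj :: "nat \<Rightarrow> 'a::finite_field mpoly \<Rightarrow> 'a mpoly set" where
  "trunc_proj n f = frob_ideal n +>\<^bsub>poly_ring n\<^esub> f"

text \<open>The copy of the ground field inside \<open>Q\<close>; dimensions are taken over it.\<close>

definition trunc_scalars :: "nat \<Rightarrow> 'a::finite_field mpoly set set" where
  "trunc_scalars n = range (\<lambda>c. trunc_proj n (mconst c))"

definition trunc_component :: "nat \<Rightarrow> nat \<Rightarrow> 'a::finite_field mpoly set set" where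
  "trunc_component n d = trunc_proj n ` homogeneous n d"

section \<open>The linear action and parabolic subgroups\<close>

definition GL :: "nat \<Rightarrow> 'a::field mat set" where
  "GL n = {g \<in> carrier_mat n n. invertible_mat g}"

definition lin_form :: "nat \<Rightarrow> 'a::field mat \<Rightarrow> nat \<Rightarrow> 'a mpoly" where
  "lin_form n g j = (\<Sum>i<n. mconst (g $$ (i, j)) * mvar i)"

definition act :: "nat \<Rightarrow> 'a::field mat \<Rightarrow> 'a mpoly \<Rightarrow> 'a mpoly" where
  "act n g f = (\<Sum>m \<in> Poly_Mapping.keys f. mconst (Poly_Mapping.lookup f m) *
     (\<Prod>j<n. lin_form n g j ^ Poly_Mapping.lookup m j))"

text \<open>
  The induced map on cosets, sending the class of \<open>f\<close> to the class of \<open>g f\<close>. The set under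
  \<^const>\<open>the_elem\<close> is a singleton; see \<open>trunc_act_proj\<close> below.
\<close>

definition trunc_act :: "nat \<Rightarrow> 'a::finite_field mat \<Rightarrow> 'a mpoly set \<Rightarrow> 'a mpoly set" where
  "trunc_act n g X = the_elem ((\<lambda>f. trunc_proj n (act n g f)) ` X)"

definition is_composition :: "nat \<Rightarrow> nat list \<Rightarrow> bool" where
  "is_composition n \<alpha> \<longleftrightarrow> (\<forall>a \<in> set \<alpha>. 0 < a) \<and> sum_list \<alpha> = n"

definition block_of :: "nat list \<Rightarrow> nat \<Rightarrow> nat" where
  "block_of \<alpha> i = (LEAST k. i < sum_list (take (Suc k) \<alpha>))"

definition parabolic :: "nat list \<Rightarrow> 'a::field mat set" where
  "parabolic \<alpha> = {g \<in> GL (sum_list \<alpha>). \<forall>i < sum_list \<alpha>. \<forall>j < sum_list \<alpha>.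
     block_of \<alpha> j < block_of \<alpha> i \<longrightarrow> g $$ (i, j) = 0}"

definition trunc_fixed :: "nat \<Rightarrow> 'a::finite_field mat set \<Rightarrow> 'a mpoly set set" where
  "trunc_fixed n G = {X \<in> carrier (trunc_ring n). \<forall>g \<in> G. trunc_act n g X = X}"

section \<open>Hilbert series\<close>

text \<open>
  The Hilbert series of a graded subspace \<open>U\<close> of \<open>Q\<close>, with \<open>U\<^bsub>d\<^esub>\<close> the part of \<open>U\<close> in
  degree \<open>d\<close>. Series have rational coefficients so that the library's division of
  formal power series is available.
\<close>

definition trunc_hilb :: "nat \<Rightarrow> 'a::finite_field mpoly set set \<Rightarrow> rat fps" where
  "trunc_hilb n U = Abs_fps (\<lambda>d. of_nat
     (ring.dim (trunc_ring n) (trunc_scalars n) (U \<inter> trunc_component n d)))"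

definition weak_comps_below :: "nat list \<Rightarrow> nat \<Rightarrow> nat list set" where
  "weak_comps_below \<alpha> m =
     {\<beta>. length \<beta> = length \<alpha> \<and> (\<forall>i < length \<alpha>. \<beta> ! i \<le> \<alpha> ! i) \<and> sum_list \<beta> \<le> m}"

abbreviation psum :: "nat list \<Rightarrow> nat \<Rightarrow> nat" where
  "psum \<beta> i \<equiv> sum_list (take i \<beta>)"

text \<open>
  With parts indexed from 0, part \<open>i\<close> runs from \<open>psum \<beta> i\<close> (conventionally \<open>B\<^bsub>i-1\<^esub>\<close>) to
  \<open>psum \<beta> (Suc i)\<close> (conventionally \<open>B\<^bsub>i\<^esub>\<close>). For \<open>q \<ge> 2\<close> no subtraction below is truncated, and
  every denominator has constant term 1, so the division is exact.
\<close>

definition Cser :: "nat \<Rightarrow> nat list \<Rightarrow> nat \<Rightarrow> rat fps" where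
  "Cser q \<alpha> m = (\<Sum>\<beta> \<in> weak_comps_below \<alpha> m.
     fps_X ^ (\<Sum>i<length \<alpha>. (\<alpha> ! i - \<beta> ! i) * (q ^ m - q ^ psum \<beta> (Suc i))) *
     ((\<Prod>j<sum_list \<beta>. 1 - fps_X ^ (q ^ m - q ^ j)) /
      (\<Prod>i<length \<alpha>. \<Prod>j<\<beta> ! i. 1 - fps_X ^ (q ^ psum \<beta> (Suc i) - q ^ (psum \<beta> i + j)))))"

section \<open>Well-definedness\<close>

text \<open>
  The action descends to \<open>Q\<close> (\<open>trunc_act_proj\<close>), and the scalars of \<open>Q\<close> form a
  subfield (\<open>subfield_trunc_scalars\<close>), as the library's notion of dimension requires.
\<close>


lemma mpoly_add_induct [case_names zero add]:
  assumes "P 0" "\<And>f m c. P f \<Longrightarrow> P (f + Poly_Mapping.single m c)"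
  shows "P (f :: 'a::comm_ring_1 mpoly)"
proof (induction f rule: update_induct)
  case const then show ?case using assms(1) by simp
next
  case (update f a b)
  have "Poly_Mapping.update a b f = f + Poly_Mapping.single a b"
    using update(1) by (intro poly_mapping_eqI)
      (auto simp: lookup_update lookup_add lookup_single when_def not_in_keys_iff_lookup_eq_zero)
  then show ?case using assms(2) update by simp
qed

lemma mconst_simps: "mconst 0 = 0" "mconst 1 = (1 :: 'a::comm_ring_1 mpoly)"
  "mconst (a + b) = mconst a + mconst (b::'a::comm_ring_1)"
  "mconst (a * b) = mconst a * mconst (b::'a::comm_ring_1)"
  by (auto simp: mconst_def single_add mult_single)

lemma act_0: "act n g 0 = 0" by (simp add: act_def)

lemma act_single:
  "act n g (Poly_Mapping.single m c) = mconst c * (\<Prod>j<n. lin_form n g j ^ Poly_Mapping.lookup m j)"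
  by (simp add: act_def mconst_simps)

lemma act_add: "act n g (f + h) = act n g f + act n g h"
  unfolding act_def by (rule setsum_keys_plus_distrib) (auto simp: mconst_simps algebra_simps)

lemma act_mult: "act n g (f * h) = act n g f * act n g h"
proof (induction f rule: mpoly_add_induct)
  case zero then show ?case by (simp add: act_0)
next
  case (add f m c)
  have "act n g (Poly_Mapping.single m c * h) = act n g (Poly_Mapping.single m c) * act n g h"
  proof (induction h rule: mpoly_add_induct)
    case zero then show ?case by (simp add: act_0)
  next
    case (add h m' c')
    have "act n g (Poly_Mapping.single m c * Poly_Mapping.single m' c') =
       act n g (Poly_Mapping.single m c) * act n g (Poly_Mapping.single m' c')"
      by (simp add: mult_single act_single mconst_simps lookup_add power_add prod.distrib mult_ac)
    then show ?case using add by (simp add: distrib_left act_add)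
  qed
  then show ?case using add by (simp add: distrib_right act_add)
qed

lemma act_mconst: "act n g (mconst c) = mconst c"
  using act_single[of n g 0 c] by (simp add: mconst_def)

lemma act_power: "act n g (f ^ k) = act n g f ^ k"
  using act_mconst[of n g 1] by (induction k) (auto simp: act_mult mconst_simps)

lemma act_mvar: "j < n \<Longrightarrow> act n g (mvar j) = lin_form n g j"
proof -
  assume j: "j < n"
  have "(\<Prod>i<n. lin_form n g i ^ (if j = i then Suc 0 else 0)) = (\<Prod>i<n. if i = j then lin_form n g i else 1)"
    by (rule prod.cong) auto
  also have "\<dots> = lin_form n g j" using j by (subst prod.delta) auto
  finally show ?thesis using act_single[of n g "Poly_Mapping.single j 1" 1]
    by (simp add: mvar_def mconst_simps lookup_single when_def)
qed

lemma polys_closed: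
  fixes f h :: "'a::comm_ring_1 mpoly"
  shows "0 \<in> polys n" "1 \<in> polys n" "f \<in> polys n \<Longrightarrow> h \<in> polys n \<Longrightarrow> f + h \<in> polys n"
    "f \<in> polys n \<Longrightarrow> -f \<in> polys n"
    "f \<in> polys n \<Longrightarrow> h \<in> polys n \<Longrightarrow> f * h \<in> polys n"
    "mconst c \<in> polys n" "i < n \<Longrightarrow> mvar i \<in> polys n"
proof -
  show "f + h \<in> polys n" if "f \<in> polys n" "h \<in> polys n"
    using that keys_add[of f h] by (auto simp: polys_def)
  show "f * h \<in> polys n" if "f \<in> polys n" "h \<in> polys n"
    unfolding polys_def
  proof clarsimp
    fix m i assume m: "m \<in> Poly_Mapping.keys (f * h)" and i: "i \<in> Poly_Mapping.keys m"
    obtain a b where ab: "m = a + b" "a \<in> Poly_Mapping.keys f" "b \<in> Poly_Mapping.keys h"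
      using m keys_mult[of f h] by blast
    have "i \<in> Poly_Mapping.keys a \<union> Poly_Mapping.keys b"
      using i keys_add[of a b] ab(1) by blast
    then show "i < n" using that ab(2,3) unfolding polys_def by blast
  qed
qed (auto simp: polys_def mconst_def mvar_def split: if_splits)

lemma polys_power: "f \<in> polys n \<Longrightarrow> f ^ k \<in> polys n" for f :: "'a::comm_ring_1 mpoly"
  by (induction k) (auto simp: polys_closed)

lemma polys_sum: "(\<And>i. i \<in> A \<Longrightarrow> f i \<in> polys n) \<Longrightarrow> sum f A \<in> polys n" for f :: "_ \<Rightarrow> 'a::comm_ring_1 mpoly"
  by (induction A rule: infinite_finite_induct) (auto simp: polys_closed)
lemma polys_prod: "(\<And>i. i \<in> A \<Longrightarrow> f i \<in> polys n) \<Longrightarrow> prod f A \<in> polys n" for f :: "_ \<Rightarrow> 'a::comm_ring_1 mpoly"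
  by (induction A rule: infinite_finite_induct) (auto simp: polys_closed)

lemma act_closed: "act n g f \<in> polys n"
  unfolding act_def lin_form_def
  by (intro polys_sum polys_prod polys_closed polys_power) auto

lemma cring_poly_ring: "cring (poly_ring n :: 'a::comm_ring_1 mpoly ring)"
proof (rule cringI)
  show "abelian_group (poly_ring n :: 'a mpoly ring)"
    by (rule abelian_groupI)
      (auto simp: poly_ring_def polys_closed algebra_simps intro!: bexI[of _ "- x" for x] polys_closed)
  show "comm_monoid (poly_ring n :: 'a mpoly ring)"
    by (rule comm_monoidI) (auto simp: poly_ring_def polys_closed algebra_simps)
qed (auto simp: poly_ring_def algebra_simps)

lemma frob_ideal_ideal: "ideal (frob_ideal n) (poly_ring n)"
proof -
  interpret cring "poly_ring n" by (rule cring_poly_ring)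
  show ?thesis unfolding frob_ideal_def
    by (rule genideal_ideal) (auto simp: poly_ring_def intro!: polys_power polys_closed)
qed

lemma card_prime_power: "\<exists>k. CARD('a::finite_field) = CHAR('a) ^ k"
proof -
  define G where "G = \<lparr>carrier = (UNIV :: 'a set), monoid.mult = (+), one = (0::'a)\<rparr>"
  have "\<exists>y. x + y = 0 \<and> y + x = 0" for x :: 'a by (rule exI[of _ "- x"]) simp
  then interpret group G
    by (intro groupI) (auto simp: G_def algebra_simps)
  have pow: "x [^]\<^bsub>G\<^esub> (k::nat) = of_nat k * x" for x k
    by (induction k) (simp_all add: G_def nat_pow_def algebra_simps)
  have "r = CHAR('a)" if r: "prime r" "r dvd CARD('a)" for r
  proof -
    obtain a m where am: "CARD('a) = r ^ a * m" "\<not> r dvd m"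
      using multiplicity_decompose'[of "CARD('a)" r] r by (metis finite_UNIV_card_ge_0 finite not_gr_zero not_prime_unit)
    have "a > 0" using am r by (cases a) auto
    obtain H where H: "subgroup H G" "card H = r ^ a"
      using sylow_thm[of r G a m] r am group_axioms unfolding order_def G_def by auto
    have "card H > 1" using H r \<open>a > 0\<close> by (metis one_less_power prime_gt_1_nat)
    then obtain x where x: "x \<in> H" "x \<noteq> 0"
      by (metis (no_types, lifting) card_le_Suc0_iff_eq One_nat_def card.infinite linorder_not_less not_one_less_zero)
    have "x [^]\<^bsub>G\<^esub> (r ^ a) = \<one>\<^bsub>G\<^esub>"
      using group.pow_order_eq_1[OF subgroup_imp_group[OF H(1)], of x] x H
      by (simp add: order_def nat_pow_consistent[symmetric])
    then have "of_nat (r ^ a) = (0::'a)" using x unfolding pow by (simp add: G_def)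
    then have "CHAR('a) dvd r ^ a" by (simp only: of_nat_eq_0_iff_char_dvd)
    then show ?thesis using r by (metis prime_CHAR_semidom prime_dvd_power primes_dvd_imp_eq CHAR_pos)
  qed
  note only = this
  have "prime CHAR('a)" by (simp add: prime_CHAR_semidom)
  then obtain a m where am: "CARD('a) = CHAR('a) ^ a * m" "\<not> CHAR('a) dvd m"
    using multiplicity_decompose'[of "CARD('a)" "CHAR('a)"]
    by (metis finite_UNIV_card_ge_0 finite not_gr_zero not_prime_unit)
  have "m = 1"
  proof (rule ccontr)
    assume "m \<noteq> 1"
    then obtain r where "prime r" "r dvd m" using prime_factor_nat by blast
    with only[of r] am show False by simp
  qed
  with am show ?thesis by auto
qed


lemma act_ideal:
  fixes g :: "'a::finite_field mat"
  assumes J: "ideal J (poly_ring n)" and gens: "\<And>j. j < n \<Longrightarrow> act n g (mvar j) ^ CARD('a) \<in> J"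
    and f: "f \<in> frob_ideal n"
  shows "act n g f \<in> J"
proof -
  interpret cring "poly_ring n :: 'a mpoly ring" by (rule cring_poly_ring)
  interpret J: ideal J "poly_ring n" by (rule J)
  have hom: "ring_hom_ring (poly_ring n) (poly_ring n) (act n g)"
    by (rule ring_hom_ringI2[OF ring_axioms ring_axioms], rule ring_hom_memI)
      (auto simp: poly_ring_def act_add act_mult act_closed act_mconst[of n g 1, unfolded mconst_simps])
  have "ideal {r \<in> carrier (poly_ring n). act n g r \<in> J} (poly_ring n)"
    using ring_hom_ring.ideal_vimage[OF hom J] .
  moreover have "(\<lambda>i. mvar i ^ CARD('a)) ` {..<n} \<subseteq> {r \<in> carrier (poly_ring n). act n g r \<in> J}"
    using gens by (auto simp: poly_ring_def act_power intro!: polys_power polys_closed)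
  ultimately show ?thesis
    using f genideal_minimal unfolding frob_ideal_def by blast
qed

lemma mconst_sum_power:
  fixes c :: "nat \<Rightarrow> 'a::finite_field"
  shows "(\<Sum>i\<in>A. mconst (c i) * mvar i) ^ CARD('a) = (\<Sum>i\<in>A. mconst (c i) * mvar i ^ CARD('a))"
proof -
  have of_nat: "of_nat k = (mconst (of_nat k) :: 'a mpoly)" for k
    by (induction k) (auto simp: mconst_simps)
  have "mconst c = 0 \<longleftrightarrow> c = 0" for c :: 'a
    unfolding mconst_def by (metis lookup_single_eq lookup_zero single_zero)
  then have ch: "CHAR('a mpoly) = CHAR('a)"
    by (intro CHAR_eqI) (auto simp: of_nat of_nat_eq_0_iff_char_dvd)
  obtain k where k: "CARD('a) = CHAR('a) ^ k" using card_prime_power by blast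
  have cpow: "mconst c ^ k = mconst (c ^ k)" for c :: 'a and k
    by (induction k) (auto simp: mconst_simps)
  have "(\<Sum>i\<in>A. mconst (c i) * mvar i) ^ CARD('a) = (\<Sum>i\<in>A. (mconst (c i) * mvar i) ^ CARD('a))"
    by (rule freshmans_dream_sum'[where n = k]) (simp_all add: ch k prime_CHAR_semidom)
  then show ?thesis
    by (simp add: power_mult_distrib cpow finite_field_power_card_eq_same)
qed

lemma act_frob_ideal:
  assumes "f \<in> frob_ideal n" shows "act n g f \<in> frob_ideal n"
proof (rule act_ideal[OF frob_ideal_ideal _ assms])
  fix j assume j: "j < n"
  interpret cring "poly_ring n :: 'a mpoly ring" by (rule cring_poly_ring)
  interpret I: ideal "frob_ideal n :: 'a mpoly set" "poly_ring n" by (rule frob_ideal_ideal)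
  have gen: "mvar i ^ CARD('a) \<in> (frob_ideal n :: 'a mpoly set)" if "i < n" for i
    using that genideal_self[of "(\<lambda>i. mvar i ^ CARD('a)) ` {..<n}"] unfolding frob_ideal_def
    by (auto simp: poly_ring_def intro!: polys_power polys_closed)
  have add: "a + b \<in> frob_ideal n" if "a \<in> frob_ideal n" "b \<in> frob_ideal n" for a b :: "'a mpoly"
    using I.a_closed[OF that] by (simp add: poly_ring_def)
  have zero: "(0 :: 'a mpoly) \<in> frob_ideal n"
    using I.zero_closed by (simp add: poly_ring_def)
  have mul: "mconst c * b \<in> frob_ideal n" if "b \<in> frob_ideal n" for c and b :: "'a mpoly"
    using I.I_l_closed[OF that, of "mconst c"] by (simp add: poly_ring_def polys_closed)
  have sum: "(\<And>i. i \<in> A \<Longrightarrow> h i \<in> frob_ideal n) \<Longrightarrow> sum h A \<in> frob_ideal n"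
    for A and h :: "nat \<Rightarrow> 'a mpoly"
    by (induction A rule: infinite_finite_induct) (auto simp: zero add)
  show "act n g (mvar j) ^ CARD('a) \<in> frob_ideal n"
    unfolding act_mvar[OF j] lin_form_def mconst_sum_power by (intro sum mul gen) auto
qed

lemma trunc_act_proj:
  assumes "f \<in> polys n"
  shows "trunc_act n g (trunc_proj n f) = trunc_proj n (act n g f)"
proof -
  interpret cring "poly_ring n :: 'a mpoly ring" by (rule cring_poly_ring)
  interpret I: ideal "frob_ideal n :: 'a mpoly set" "poly_ring n" by (rule frob_ideal_ideal)
  have f: "f \<in> carrier (poly_ring n)" using assms by (simp add: poly_ring_def)
  have "trunc_proj n (act n g h) = trunc_proj n (act n g f)" if h: "h \<in> trunc_proj n f" for h
  proof -
    from h obtain i where i: "i \<in> frob_ideal n" "h = i + f"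
      unfolding trunc_proj_def a_r_coset_def' by (auto simp: poly_ring_def)
    have "act n g h \<in> trunc_proj n (act n g f)"
      unfolding trunc_proj_def a_r_coset_def'
      using act_frob_ideal[OF i(1)] by (auto simp: i(2) act_add poly_ring_def)
    then show ?thesis unfolding trunc_proj_def
      by (rule I.a_repr_independence'[symmetric]) (simp_all add: poly_ring_def act_closed)
  qed
  moreover have "f \<in> trunc_proj n f"
    unfolding trunc_proj_def using I.a_rcos_self[OF f] .
  ultimately have "(\<lambda>h. trunc_proj n (act n g h)) ` trunc_proj n f = {trunc_proj n (act n g f)}"
    by blast
  then show ?thesis by (simp add: trunc_act_def)
qed

lemma subfield_trunc_scalars: "subfield (trunc_scalars n) (trunc_ring n :: 'a::finite_field mpoly set ring)"
proof -
  interpret cring "poly_ring n :: 'a mpoly ring" by (rule cring_poly_ring)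
  interpret I: ideal "frob_ideal n :: 'a mpoly set" "poly_ring n" by (rule frob_ideal_ideal)
  have "(1 :: 'a mpoly) \<notin> frob_ideal n"
  proof
    assume one: "(1 :: 'a mpoly) \<in> frob_ideal n"
    have "act n (0\<^sub>m n n) (1 :: 'a mpoly) \<in> {\<zero>\<^bsub>poly_ring n\<^esub>}"
      using one
      by (rule act_ideal[OF zeroideal, rotated])
        (auto simp: poly_ring_def act_mvar lin_form_def mconst_simps)
    then show False using act_mconst[of n "0\<^sub>m n n" "1::'a"] by (simp add: mconst_simps poly_ring_def)
  qed
  then have ne: "\<one>\<^bsub>trunc_ring n\<^esub> \<noteq> \<zero>\<^bsub>trunc_ring n :: 'a mpoly set ring\<^esub>"
    using I.a_rcos_self[OF one_closed] by (auto simp: trunc_ring_def FactRing_def poly_ring_def)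
  interpret h: ring_hom_ring "poly_ring n :: 'a mpoly ring" "trunc_ring n" "trunc_proj n"
    using I.rcos_ring_hom_ring by (simp add: trunc_ring_def trunc_proj_def[abs_def])
  have sub: "range mconst \<subseteq> carrier (poly_ring n :: 'a mpoly ring)"
    by (auto simp: poly_ring_def polys_closed)
  have neg: "\<ominus>\<^bsub>poly_ring n\<^esub> mconst c = mconst (- c)" for c :: 'a
    by (rule minus_equality) (use mconst_simps(3)[of "- c" c] in \<open>auto simp: mconst_simps(1) poly_ring_def polys_closed\<close>)
  have "subcring (range mconst) (poly_ring n :: 'a mpoly ring)"
    by (rule subcringI'[OF subringI[OF sub]])
      (auto simp: neg, auto simp: poly_ring_def simp flip: mconst_simps)
  moreover have "Units (poly_ring n \<lparr>carrier := range mconst\<rparr>) = range mconst - {\<zero>\<^bsub>poly_ring n :: 'a mpoly ring\<^esub>}"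
  proof -
    have "mconst c * mconst (inverse c) = (1 :: 'a mpoly)" if "mconst c \<noteq> (0 :: 'a mpoly)" for c
      using that by (cases "c = 0") (simp_all add: mconst_simps(1,2) flip: mconst_simps(4))
    then show ?thesis
      by (fastforce simp: Units_def poly_ring_def mult.commute)
  qed
  ultimately have "subfield (range mconst) (poly_ring n :: 'a mpoly ring)"
    by (rule subfieldI)
  from h.img_is_subfield(2)[OF this ne] show ?thesis
    by (simp add: trunc_scalars_def image_image)
qed

end

theory Submission
  imports Defs "Jordan_Normal_Form.Gauss_Jordan_Elimination" "HOL-Computational_Algebra.Polynomial"
begin

text \<open>
  The monomials with all exponents below \<open>q\<close> form a basis of \<open>Q\<close>. Invariance under the
  diagonal matrices forces every exponent of an invariant to be \<open>0\<close> or \<open>q - 1\<close>, and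
  invariance under the transvections \<open>x\<^sub>j \<mapsto> x\<^sub>j + x\<^sub>i\<close> in the parabolic forces the support of each
  monomial to contain \<open>i\<close> whenever it contains \<open>j\<close>. So the only candidates are the products of the
  \<open>x\<^sub>i\<^bsup>q-1\<^esup>\<close> over the first \<open>N = \<alpha>\<^sub>1 + \<dots> + \<alpha>\<^sub>k\<close> variables.

  Such a product is indeed invariant. If \<open>F\<close> is homogeneous of degree \<open>N (q - 1)\<close> in \<open>N\<close> variables,
  then only its coefficient at this monomial survives in \<open>Q\<close>, and that coefficient is
  \<open>(-1)\<^sup>N\<close> times the sum of the values of \<open>F\<close> at all points of the affine space over the field. This sum does
  not change under an invertible linear substitution.

  For \<open>m = 1\<close> the weak compositions \<open>\<beta>\<close> are zero and the unit vectors, and all quotients in the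
  series are \<open>1\<close>; what remains is the sum of \<open>t\<^bsup>N (q-1)\<^esup>\<close> over the partial sums \<open>N\<close> of \<open>\<alpha>\<close>.
\<close>

section \<open>Monomials and their coefficients\<close>

lemma mvar_power: "mvar i ^ k = (Poly_Mapping.single (Poly_Mapping.single i k) 1 :: 'a::comm_ring_1 mpoly)"
proof (induction k)
  case (Suc k)
  have "Poly_Mapping.single i (Suc k) = Poly_Mapping.single i 1 + Poly_Mapping.single i k"
    by (simp flip: single_add)
  then show ?case using Suc by (simp add: mvar_def mult_single)
qed simp

lemma prod_mvar_power:
  "(\<Prod>i\<in>A. mvar i ^ e i) =
    (Poly_Mapping.single (\<Sum>i\<in>A. Poly_Mapping.single i (e i)) 1 :: 'a::comm_ring_1 mpoly)"
  by (induction A rule: infinite_finite_induct) (auto simp: mvar_power mult_single)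

lemma lookup_sum_single:
  "finite A \<Longrightarrow> Poly_Mapping.lookup (\<Sum>i\<in>A. Poly_Mapping.single i (e i)) k = (if k \<in> A then e k else 0)"
  by (simp add: lookup_sum lookup_single when_def)

lemma mono_eq_prod_mvar:
  assumes "Poly_Mapping.keys m \<subseteq> {..<n}"
  shows "(\<Prod>i<n. mvar i ^ Poly_Mapping.lookup m i) = (Poly_Mapping.single m 1 :: 'a::comm_ring_1 mpoly)"
proof -
  have "(\<Sum>i<n. Poly_Mapping.single i (Poly_Mapping.lookup m i)) = m"
    by (rule poly_mapping_eqI) (use assms in \<open>auto simp: lookup_sum_single in_keys_iff\<close>)
  then show ?thesis by (simp add: prod_mvar_power)
qed

lemma mpoly_eq_sum_single:
  "f = (\<Sum>m\<in>Poly_Mapping.keys f. Poly_Mapping.single m (Poly_Mapping.lookup f m))"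
  by (rule poly_mapping_eqI) (auto simp: lookup_sum lookup_single when_def in_keys_iff)

lemma lookup_mconst_mult:
  "Poly_Mapping.lookup (mconst c * f) m = c * Poly_Mapping.lookup f m" for f :: "'a::comm_ring_1 mpoly"
  by (induction f rule: mpoly_add_induct)
    (auto simp: distrib_left lookup_add mconst_def mult_single lookup_single when_def)

text \<open>Serves to drop everything divisible by a variable when a coefficient free of that
  variable is read off.\<close>

lemma lookup_mvar_mult_eq_0:
  fixes h :: "'a::comm_ring_1 mpoly"
  assumes "Poly_Mapping.lookup m i = 0"
  shows "Poly_Mapping.lookup (mvar i * h) m = 0"
proof (rule ccontr)
  assume "\<not> ?thesis"
  then have "m \<in> Poly_Mapping.keys (mvar i * h)" by (simp add: in_keys_iff)
  then obtain a b where "m = a + b" "a \<in> Poly_Mapping.keys (mvar i :: 'a mpoly)"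
    using keys_mult by blast
  then show False using assms by (auto simp: mvar_def lookup_add split: if_splits)
qed

section \<open>Reduced monomials\<close>

text \<open>Exponents of variables with index at least \<open>n\<close> are left free; monomials of
  elements of \<open>polys n\<close> have none.\<close>

definition reduced :: "nat \<Rightarrow> nat \<Rightarrow> (nat \<Rightarrow>\<^sub>0 nat) \<Rightarrow> bool" where
  "reduced q n m \<longleftrightarrow> (\<forall>i<n. Poly_Mapping.lookup m i < q)"

lemma poly_ring_simps:
  "carrier (poly_ring n) = polys n" "x \<otimes>\<^bsub>poly_ring n\<^esub> y = x * y" "x \<oplus>\<^bsub>poly_ring n\<^esub> y = x + y"
  "\<one>\<^bsub>poly_ring n\<^esub> = 1" "\<zero>\<^bsub>poly_ring n\<^esub> = 0"
  by (simp_all add: poly_ring_def)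

lemma poly_ring_minus:
  fixes f h :: "'a::comm_ring_1 mpoly"
  assumes "f \<in> polys n" "h \<in> polys n"
  shows "f \<ominus>\<^bsub>poly_ring n\<^esub> h = f - h"
proof -
  interpret cring "poly_ring n :: 'a mpoly ring" by (rule cring_poly_ring)
  have "\<ominus>\<^bsub>poly_ring n\<^esub> h = - h"
    by (rule minus_equality) (use assms in \<open>auto simp: poly_ring_simps polys_closed\<close>)
  then show ?thesis by (simp add: a_minus_def poly_ring_simps)
qed

text \<open>Multiplication only raises exponents, so the right-hand side is an ideal containing the
  generators. Conversely, a monomial with an exponent of at least q is a multiple of a generator,
  and each element is the sum of its terms.\<close>

lemma frob_ideal_eq:
  "(frob_ideal n :: 'a::finite_field mpoly set) =
    {f \<in> polys n. \<forall>m\<in>Poly_Mapping.keys f. \<not> reduced CARD('a) n m}" (is "_ = ?J")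
proof
  interpret cring "poly_ring n :: 'a mpoly ring" by (rule cring_poly_ring)
  interpret I: ideal "frob_ideal n :: 'a mpoly set" "poly_ring n" by (rule frob_ideal_ideal)
  have mult: "h * f \<in> ?J" if "f \<in> ?J" "h \<in> polys n" for f h :: "'a mpoly"
  proof -
    have "\<not> reduced CARD('a) n m" if "m \<in> Poly_Mapping.keys (h * f)" for m
    proof -
      from that obtain a b where ab: "m = a + b" "b \<in> Poly_Mapping.keys f"
        using keys_mult by blast
      then obtain i where "i < n" "CARD('a) \<le> Poly_Mapping.lookup b i"
        using \<open>f \<in> ?J\<close> by (auto simp: reduced_def not_less)
      then show ?thesis using ab(1)
        by (auto simp: reduced_def lookup_add not_less intro!: exI[of _ i])
    qed
    then show ?thesis using that by (auto simp: polys_closed)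
  qed
  have "ideal ?J (poly_ring n)"
  proof (rule idealI)
    show "subgroup ?J (add_monoid (poly_ring n))"
    proof (rule add.subgroupI)
      show "a \<oplus>\<^bsub>poly_ring n\<^esub> b \<in> ?J" if "a \<in> ?J" "b \<in> ?J" for a b
        using that keys_add[of a b] by (auto simp: poly_ring_simps polys_closed)
      show "\<ominus>\<^bsub>poly_ring n\<^esub> a \<in> ?J" if "a \<in> ?J" for a
      proof -
        have "\<ominus>\<^bsub>poly_ring n\<^esub> a = - a"
          by (rule minus_equality) (use that in \<open>auto simp: poly_ring_simps polys_closed\<close>)
        then show ?thesis using that by (auto simp: polys_closed in_keys_iff)
      qed
      have "0 \<in> ?J" by (auto simp: polys_closed)
      then show "?J \<noteq> {}" by blast
    qed (auto simp: poly_ring_simps)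
    show "x \<otimes>\<^bsub>poly_ring n\<^esub> a \<in> ?J" if "a \<in> ?J" "x \<in> carrier (poly_ring n)" for a x
      unfolding poly_ring_simps by (rule mult) (use that in \<open>auto simp: poly_ring_simps\<close>)
    show "a \<otimes>\<^bsub>poly_ring n\<^esub> x \<in> ?J" if "a \<in> ?J" "x \<in> carrier (poly_ring n)" for a x
      unfolding poly_ring_simps mult.commute[of a x]
      by (rule mult) (use that in \<open>auto simp: poly_ring_simps\<close>)
  qed (rule ring_axioms)
  moreover have "(\<lambda>i. mvar i ^ CARD('a)) ` {..<n} \<subseteq> ?J"
    by (auto intro!: polys_power polys_closed simp: reduced_def) (auto simp: mvar_power)
  ultimately show "frob_ideal n \<subseteq> ?J"
    unfolding frob_ideal_def by (rule genideal_minimal)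
  show "?J \<subseteq> frob_ideal n"
  proof
    fix f assume f: "f \<in> ?J"
    have sum: "(\<And>i. i \<in> A \<Longrightarrow> h i \<in> frob_ideal n) \<Longrightarrow> sum h A \<in> frob_ideal n"
      for A and h :: "(nat \<Rightarrow>\<^sub>0 nat) \<Rightarrow> 'a mpoly"
      using I.zero_closed I.a_closed
      by (induction A rule: infinite_finite_induct) (auto simp: poly_ring_simps)
    have "Poly_Mapping.single m (Poly_Mapping.lookup f m) \<in> frob_ideal n"
      if m: "m \<in> Poly_Mapping.keys f" for m
    proof -
      let ?q = "CARD('a)"
      from m f obtain i where i: "i < n" "?q \<le> Poly_Mapping.lookup m i"
        by (auto simp: reduced_def not_less)
      let ?s = "Poly_Mapping.single i ?q"
      have sub: "Poly_Mapping.keys m \<subseteq> {..<n}" using m f by (auto simp: polys_def)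
      \<comment> \<open>Subtraction of exponent vectors is truncated; it is exact here because the
        exponent of \<open>m\<close> at \<open>i\<close> is at least q.\<close>
      have eq: "m - ?s + ?s = m"
        using i by (intro poly_mapping_eqI) (auto simp: lookup_add lookup_minus lookup_single when_def)
      have "Poly_Mapping.keys (m - ?s) \<subseteq> Poly_Mapping.keys m"
        by (auto simp: in_keys_iff lookup_minus)
      then have p: "Poly_Mapping.single (m - ?s) (Poly_Mapping.lookup f m) \<in> polys n"
        using sub by (auto simp: polys_def split: if_splits)
      have "mvar i ^ ?q \<in> (frob_ideal n :: 'a mpoly set)"
        using i genideal_self[of "(\<lambda>i. mvar i ^ ?q) ` {..<n}"] unfolding frob_ideal_def
        by (auto simp: poly_ring_simps intro!: polys_power polys_closed)
      from I.I_l_closed[OF this, of "Poly_Mapping.single (m - ?s) (Poly_Mapping.lookup f m)"] p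
      show ?thesis by (simp add: poly_ring_simps mvar_power mult_single eq)
    qed
    then show "f \<in> frob_ideal n"
      by (subst mpoly_eq_sum_single) (rule sum)
  qed
qed

text \<open>This makes the reduced monomials a basis of Q: equality of cosets becomes equality of
  coefficients, which is how Q is handled from here on.\<close>

lemma trunc_proj_eq_iff:
  fixes f h :: "'a::finite_field mpoly"
  assumes "f \<in> polys n" "h \<in> polys n"
  shows "trunc_proj n f = trunc_proj n h \<longleftrightarrow>
    (\<forall>m. reduced CARD('a) n m \<longrightarrow> Poly_Mapping.lookup f m = Poly_Mapping.lookup h m)"
proof -
  interpret cring "poly_ring n :: 'a mpoly ring" by (rule cring_poly_ring)
  have "trunc_proj n f = trunc_proj n h \<longleftrightarrow> f - h \<in> frob_ideal n"
    using quotient_eq_iff_same_a_r_cos[OF frob_ideal_ideal, of f h] assms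
    by (simp add: trunc_proj_def poly_ring_simps poly_ring_minus)
  moreover have "f - h \<in> polys n"
    using polys_closed(3)[OF assms(1) polys_closed(4)[OF assms(2)]] by simp
  ultimately show ?thesis
    by (auto simp: frob_ideal_eq in_keys_iff lookup_minus)
qed

text \<open>Dropping the non-reduced terms keeps the degree and, when q is the field size, the class
  in Q. The support of the representative is then determined by the class.\<close>

lemma reduced_representative:
  fixes f :: "'a::zero mpoly"
  assumes "f \<in> homogeneous n d"
  obtains h where "h \<in> homogeneous n d" "\<forall>m\<in>Poly_Mapping.keys h. reduced q n m"
    "\<forall>m. reduced q n m \<longrightarrow> Poly_Mapping.lookup h m = Poly_Mapping.lookup f m"
proof -
  define h where "h = Poly_Mapping.mapp (\<lambda>m c. if reduced q n m then c else 0) f"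
  have lk: "Poly_Mapping.lookup h m = (if reduced q n m then Poly_Mapping.lookup f m else 0)" for m
    by (auto simp: h_def lookup_mapp when_def in_keys_iff)
  show ?thesis
  proof (rule that)
    show "h \<in> homogeneous n d" using assms
      by (auto simp: homogeneous_def polys_def in_keys_iff lk split: if_splits)
  qed (auto simp: lk in_keys_iff split: if_splits)
qed

lemma lookup_act:
  fixes f :: "'a::field mpoly"
  shows "Poly_Mapping.lookup (act n g f) M = (\<Sum>m\<in>Poly_Mapping.keys f. Poly_Mapping.lookup f m *
    Poly_Mapping.lookup (\<Prod>j<n. lin_form n g j ^ Poly_Mapping.lookup m j) M)"
  by (simp add: act_def lookup_sum lookup_mconst_mult)

section \<open>Power sums over a finite field\<close>

lemma card_finite_field_ge_2: "CARD('a::finite_field) \<ge> 2"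
proof -
  have "card {0, 1 :: 'a} \<le> CARD('a)" by (rule card_mono) auto
  then show ?thesis by simp
qed

lemma power_card_minus_1: "x ^ (CARD('a) - 1) = 1" if "x \<noteq> 0" for x :: "'a::finite_field"
proof -
  have "x * x ^ (CARD('a) - 1) = x * 1"
    using finite_field_power_card_eq_same[of x] power_Suc[of x "CARD('a) - 1"] by simp
  then show ?thesis using that by (metis mult_cancel_left)
qed

text \<open>The polynomial \<open>t^k - 1\<close> has at most \<open>k\<close> roots, fewer than
  there are nonzero field elements.\<close>

lemma ex_power_neq_1:
  assumes "0 < k" "k < CARD('a::finite_field) - 1"
  shows "\<exists>x::'a. x \<noteq> 0 \<and> x ^ k \<noteq> 1"
proof (rule ccontr)
  assume "\<not> ?thesis"
  then have "- {0::'a} \<subseteq> {x. poly (Polynomial.monom 1 k - 1) x = 0}" by (auto simp: Polynomial.poly_monom)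
  then have "card (- {0::'a}) \<le> card {x::'a. poly (Polynomial.monom 1 k - 1) x = 0}" by (rule card_mono[rotated]) simp
  also have "\<dots> \<le> k"
  proof -
    have "Polynomial.coeff (Polynomial.monom 1 k - 1 :: 'a poly) k = 1" using assms by simp
    then have nz: "(Polynomial.monom 1 k - 1 :: 'a poly) \<noteq> 0" by (metis Polynomial.coeff_0 zero_neq_one)
    have "Polynomial.degree (Polynomial.monom 1 k - 1 :: 'a poly) \<le> k"
      by (rule Polynomial.degree_diff_le) (auto simp: Polynomial.degree_monom_le)
    then show ?thesis using card_poly_roots_bound[OF nz] by linarith
  qed
  finally show False using assms by (simp add: Compl_eq_Diff_UNIV card_Diff_singleton)
qed

text \<open>Substituting \<open>a * x\<close> for \<open>x\<close> multiplies the sum by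
  \<open>a ^ k\<close>, so a suitable \<open>a\<close> forces it to vanish. For exponent 0 no such
  \<open>a\<close> exists, and the sum is q times 1 because \<open>0 ^ 0 = 1\<close>.\<close>

lemma sum_power_finite_field:
  assumes "k < CARD('a::finite_field) - 1"
  shows "(\<Sum>x\<in>(UNIV::'a set). x ^ k) = 0"
proof (cases "k = 0")
  case True
  \<comment> \<open>The shift by 1 permutes the field, so adding 1 to every element leaves the total
    unchanged; hence q times 1 is 0.\<close>
  have "(\<Sum>x\<in>(UNIV::'a set). x) = (\<Sum>x\<in>UNIV. x + 1)"
    by (rule sum.reindex_bij_witness[of _ "\<lambda>x. x + 1" "\<lambda>x. x - 1"]) auto
  then show ?thesis using True by (simp add: sum.distrib)
next
  case False
  then obtain a :: 'a where a: "a \<noteq> 0" "a ^ k \<noteq> 1" using ex_power_neq_1 assms by blast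
  have "(\<Sum>x\<in>(UNIV::'a set). x ^ k) = (\<Sum>x\<in>UNIV. (a * x) ^ k)"
    by (rule sum.reindex_bij_witness[of _ "\<lambda>x. a * x" "\<lambda>x. x / a"]) (use a in auto)
  also have "\<dots> = a ^ k * (\<Sum>x\<in>UNIV. x ^ k)" by (simp add: power_mult_distrib sum_distrib_left)
  finally show ?thesis using a by simp
qed

text \<open>Every nonzero element contributes 1 and zero contributes 0, which leaves q - 1 copies of
  1, and q is 0 in the field.\<close>

lemma sum_power_card_minus_1: "(\<Sum>x\<in>(UNIV::'a::finite_field set). x ^ (CARD('a) - 1)) = -1"
proof -
  have q: "(of_nat CARD('a) :: 'a) = 0"
    using sum_power_finite_field[where 'a='a, of 0] card_finite_field_ge_2[where 'a='a] by simp
  have "(\<Sum>x\<in>(UNIV::'a set). x ^ (CARD('a) - 1)) = (\<Sum>x\<in>(UNIV::'a set). 1 - (if x = 0 then 1 else 0))"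
    by (rule sum.cong) (use card_finite_field_ge_2[where 'a='a] in \<open>auto simp: power_card_minus_1[simplified] power_0_left\<close>)
  then show ?thesis by (simp add: sum_subtractf q)
qed

section \<open>Evaluation of polynomials\<close>

text \<open>Variables with index at least \<open>N\<close> are in effect set to 1, so evaluation is
  a ring homomorphism on all polynomials, not only on \<open>polys N\<close>.\<close>

definition eval_mpoly :: "nat \<Rightarrow> (nat \<Rightarrow> 'a) \<Rightarrow> 'a mpoly \<Rightarrow> 'a::comm_ring_1" where
  "eval_mpoly N v f = (\<Sum>m\<in>Poly_Mapping.keys f. Poly_Mapping.lookup f m * (\<Prod>i<N. v i ^ Poly_Mapping.lookup m i))"

lemma eval_mpoly_0: "eval_mpoly N v 0 = 0" by (simp add: eval_mpoly_def)

lemma eval_mpoly_single: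
  "eval_mpoly N v (Poly_Mapping.single m c) = c * (\<Prod>i<N. v i ^ Poly_Mapping.lookup m i)"
  by (simp add: eval_mpoly_def)

lemma eval_mpoly_add: "eval_mpoly N v (f + h) = eval_mpoly N v f + eval_mpoly N v h"
  unfolding eval_mpoly_def by (rule setsum_keys_plus_distrib) (auto simp: algebra_simps)

lemma eval_mpoly_mult: "eval_mpoly N v (f * h) = eval_mpoly N v f * eval_mpoly N v h"
proof (induction f rule: mpoly_add_induct)
  case zero then show ?case by (simp add: eval_mpoly_0)
next
  case (add f m c)
  have "eval_mpoly N v (Poly_Mapping.single m c * h) = eval_mpoly N v (Poly_Mapping.single m c) * eval_mpoly N v h"
    by (induction h rule: mpoly_add_induct)
      (auto simp: eval_mpoly_0 eval_mpoly_add eval_mpoly_single mult_single distrib_left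
        lookup_add power_add prod.distrib mult_ac)
  then show ?case using add by (simp add: distrib_right eval_mpoly_add)
qed

lemma eval_mpoly_mconst: "eval_mpoly N v (mconst c) = c"
  by (simp add: mconst_def eval_mpoly_single)

lemma eval_mpoly_mvar: "i < N \<Longrightarrow> eval_mpoly N v (mvar i) = v i"
proof -
  assume i: "i < N"
  have "(\<Prod>k<N. v k ^ (if i = k then Suc 0 else 0)) = (\<Prod>k<N. if k = i then v k else 1)"
    by (rule prod.cong) auto
  then show ?thesis using i
    by (simp add: mvar_def eval_mpoly_single lookup_single when_def)
qed

lemma eval_mpoly_power: "eval_mpoly N v (f ^ k) = eval_mpoly N v f ^ k"
  using eval_mpoly_mconst[of N v 1]
  by (induction k) (auto simp: eval_mpoly_mult mconst_simps)

lemma eval_mpoly_sum: "eval_mpoly N v (sum f A) = (\<Sum>i\<in>A. eval_mpoly N v (f i))"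
  by (induction A rule: infinite_finite_induct) (auto simp: eval_mpoly_0 eval_mpoly_add)

lemma eval_mpoly_prod: "eval_mpoly N v (prod f A) = (\<Prod>i\<in>A. eval_mpoly N v (f i))"
  using eval_mpoly_mconst[of N v 1]
  by (induction A rule: infinite_finite_induct) (auto simp: eval_mpoly_mult mconst_simps)

section \<open>Homogeneous polynomials\<close>

lemma homogeneous_add:
  fixes f h :: "'a::comm_ring_1 mpoly"
  shows "f \<in> homogeneous n d \<Longrightarrow> h \<in> homogeneous n d \<Longrightarrow> f + h \<in> homogeneous n d"
  using keys_add[of f h] by (auto simp: homogeneous_def polys_closed)

lemma homogeneous_mult:
  fixes f h :: "'a::comm_ring_1 mpoly"
  assumes "f \<in> homogeneous n d" "h \<in> homogeneous n e" 
  shows "f * h \<in> homogeneous n (d + e)"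
  unfolding homogeneous_def
proof (intro CollectI conjI ballI)
  show "f * h \<in> polys n" using assms by (auto simp: homogeneous_def polys_closed)
  fix m assume "m \<in> Poly_Mapping.keys (f * h)"
  then obtain a b where "m = a + b" "a \<in> Poly_Mapping.keys f" "b \<in> Poly_Mapping.keys h"
    using keys_mult by blast
  then show "(\<Sum>i<n. Poly_Mapping.lookup m i) = d + e"
    using assms by (simp add: homogeneous_def lookup_add sum.distrib)
qed

lemma homogeneous_single:
  "Poly_Mapping.keys m \<subseteq> {..<n} \<Longrightarrow> (\<Sum>i<n. Poly_Mapping.lookup m i) = d \<Longrightarrow>
    Poly_Mapping.single m c \<in> homogeneous n d"
  by (auto simp: homogeneous_def polys_def)

lemma homogeneous_mconst: "mconst c \<in> homogeneous n 0"
  unfolding mconst_def by (rule homogeneous_single) auto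

lemma homogeneous_mvar: "i < n \<Longrightarrow> mvar i \<in> homogeneous n 1"
  unfolding mvar_def by (rule homogeneous_single) (auto simp: lookup_single when_def)

lemma homogeneous_sum:
  fixes f :: "'b \<Rightarrow> 'a::comm_ring_1 mpoly"
  shows "(\<And>i. i \<in> A \<Longrightarrow> f i \<in> homogeneous n d) \<Longrightarrow> sum f A \<in> homogeneous n d"
  by (induction A rule: infinite_finite_induct)
    (auto simp: homogeneous_add, auto simp: homogeneous_def polys_closed)

lemma homogeneous_prod:
  fixes f :: "'b \<Rightarrow> 'a::comm_ring_1 mpoly"
  shows "(\<And>i. i \<in> A \<Longrightarrow> f i \<in> homogeneous n (d i)) \<Longrightarrow> prod f A \<in> homogeneous n (sum d A)"
  using homogeneous_mconst[of "1::'a"]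
  by (induction A rule: infinite_finite_induct) (auto simp: homogeneous_mult mconst_simps)

lemma homogeneous_power:
  fixes f :: "'a::comm_ring_1 mpoly"
  shows "f \<in> homogeneous n d \<Longrightarrow> f ^ k \<in> homogeneous n (k * d)"
  using homogeneous_mconst[of "1::'a"]
  by (induction k) (auto simp: homogeneous_mult mconst_simps)

section \<open>Corner monomials\<close>

text \<open>The exponent vector of the reduced monomial of highest degree in the first
  \<open>N\<close> variables.\<close>

definition corner :: "nat \<Rightarrow> nat \<Rightarrow> nat \<Rightarrow>\<^sub>0 nat" where
  "corner q N = (\<Sum>i<N. Poly_Mapping.single i (q - 1))"

lemma lookup_corner: "Poly_Mapping.lookup (corner q N) i = (if i < N then q - 1 else 0)"
  by (simp add: corner_def lookup_sum_single)

lemma corner_homogeneous: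
  assumes "N \<le> n"
  shows "Poly_Mapping.single (corner q N) c \<in> homogeneous n (N * (q - 1))"
proof (rule homogeneous_single)
  show "Poly_Mapping.keys (corner q N) \<subseteq> {..<n}"
    using assms by (auto simp: in_keys_iff lookup_corner split: if_splits)
  have "(\<Sum>i<n. Poly_Mapping.lookup (corner q N) i) = (\<Sum>i\<in>{..<n} \<inter> {i. i < N}. q - 1)"
    unfolding lookup_corner by (subst sum.inter_restrict) auto
  also have "{..<n} \<inter> {i. i < N} = {..<N}" using assms by auto
  finally show "(\<Sum>i<n. Poly_Mapping.lookup (corner q N) i) = N * (q - 1)" by simp
qed

text \<open>Numbers that all lie on one side of their prescribed average are all equal to it. The
  upper bound fits reduced monomials, the lower bound fits monomials whose power sum over the field
  does not vanish.\<close>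

lemma eq_cornerI:
  assumes "Poly_Mapping.keys m \<subseteq> {..<N}" "(\<Sum>i<N. Poly_Mapping.lookup m i) = N * (q - 1)"
    and "(\<forall>i<N. Poly_Mapping.lookup m i \<le> q - 1) \<or> (\<forall>i<N. q - 1 \<le> Poly_Mapping.lookup m i)"
  shows "m = corner q N"
proof -
  have eq: "(\<Sum>i<N. Poly_Mapping.lookup m i) = (\<Sum>i<N. q - 1)" using assms(2) by simp
  have "\<forall>i<N. Poly_Mapping.lookup m i = q - 1"
    using assms(3)
  proof
    assume *: "\<forall>i<N. Poly_Mapping.lookup m i \<le> q - 1"
    show ?thesis using sum_mono_inv[OF eq] * by (metis finite_lessThan lessThan_iff)
  next
    assume *: "\<forall>i<N. q - 1 \<le> Poly_Mapping.lookup m i"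
    show ?thesis using sum_mono_inv[OF eq[symmetric]] * by (metis finite_lessThan lessThan_iff)
  qed
  moreover have "Poly_Mapping.lookup m i = 0" if "\<not> i < N" for i
    using assms(1) that by (meson in_keys_iff lessThan_iff subsetD)
  ultimately show ?thesis
    by (intro poly_mapping_eqI) (simp add: lookup_corner)
qed

text \<open>For each monomial the sum over all points factors into one-variable power sums. A
  monomial of this degree other than the corner has an exponent below q - 1, and that factor is
  zero.\<close>

lemma sum_eval_mpoly:
  fixes f :: "'a::finite_field mpoly"
  assumes f: "f \<in> homogeneous N (N * (CARD('a) - 1))"
  shows "(\<Sum>v\<in>{..<N} \<rightarrow>\<^sub>E UNIV. eval_mpoly N v f) = (-1) ^ N * Poly_Mapping.lookup f (corner CARD('a) N)"
proof -
  let ?q = "CARD('a)" and ?c = "corner CARD('a) N"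
  have vanish: "(\<Prod>i<N. \<Sum>x\<in>(UNIV::'a set). x ^ Poly_Mapping.lookup m i) = 0"
    if "m \<in> Poly_Mapping.keys f" "m \<noteq> ?c" for m
  proof -
    have "\<not> (\<forall>i<N. ?q - 1 \<le> Poly_Mapping.lookup m i)"
      using eq_cornerI[of m N ?q] that f by (auto simp: homogeneous_def polys_def)
    then obtain i where "i < N" "Poly_Mapping.lookup m i < ?q - 1" by (auto simp: not_le)
    then show ?thesis by (auto simp: sum_power_finite_field intro!: prod_zero bexI[of _ i])
  qed
  have "(\<Sum>v\<in>{..<N} \<rightarrow>\<^sub>E UNIV. eval_mpoly N v f) =
      (\<Sum>m\<in>Poly_Mapping.keys f. Poly_Mapping.lookup f m *
        (\<Sum>v\<in>{..<N} \<rightarrow>\<^sub>E UNIV. \<Prod>i<N. v i ^ Poly_Mapping.lookup m i))"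
    unfolding eval_mpoly_def sum_distrib_left by (rule sum.swap)
  also have "\<dots> = (\<Sum>m\<in>Poly_Mapping.keys f. Poly_Mapping.lookup f m *
        (\<Prod>i<N. \<Sum>x\<in>(UNIV::'a set). x ^ Poly_Mapping.lookup m i))"
    by (simp only: prod_sum_PiE[OF finite_lessThan finite])
  also have "\<dots> = (\<Sum>m\<in>{?c}. Poly_Mapping.lookup f m *
        (\<Prod>i<N. \<Sum>x\<in>(UNIV::'a set). x ^ Poly_Mapping.lookup m i))"
  \<comment> \<open>The corner may be absent from the support of \<open>f\<close>, so the terms in
    both set differences have to vanish.\<close>
  proof (rule sum.mono_neutral_cong)
    show "Poly_Mapping.lookup f i * (\<Prod>j<N. \<Sum>x\<in>(UNIV::'a set). x ^ Poly_Mapping.lookup i j) = 0"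
      if "i \<in> Poly_Mapping.keys f - {?c}" for i using vanish[of i] that by simp
    show "Poly_Mapping.lookup f i * (\<Prod>j<N. \<Sum>x\<in>(UNIV::'a set). x ^ Poly_Mapping.lookup i j) = 0"
      if "i \<in> {?c} - Poly_Mapping.keys f" for i using that by (auto simp: in_keys_iff)
  qed auto
  also have "\<dots> = (-1) ^ N * Poly_Mapping.lookup f ?c"
    using sum_power_card_minus_1[where 'a='a] by (simp add: lookup_corner mult.commute)
  finally show ?thesis .
qed

text \<open>The block condition says that \<open>g\<close> maps the span of the first
  \<open>N\<close> variables to itself, so the image is a polynomial \<open>F\<close> in these
  variables only. Its degree excludes every reduced monomial but the corner, and the sum over all
  points gives the corner coefficient.\<close>

lemma act_corner:
  fixes g :: "'a::finite_field mat"
  assumes "N \<le> n" and g: "g \<in> GL n"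
    and block: "\<And>i j. N \<le> i \<Longrightarrow> i < n \<Longrightarrow> j < N \<Longrightarrow> g $$ (i, j) = 0"
  shows "trunc_proj n (act n g (Poly_Mapping.single (corner CARD('a) N) 1)) =
    trunc_proj n (Poly_Mapping.single (corner CARD('a) N) 1)"
proof -
  let ?q = "CARD('a)" and ?c = "corner CARD('a) N" and ?V = "{..<N} \<rightarrow>\<^sub>E (UNIV :: 'a set)"
  \<comment> \<open>\<open>T\<close> is the transpose of the upper left block of \<open>g\<close>,
    so that evaluating \<open>F\<close> at \<open>v\<close> is evaluating the corner monomial at
    \<open>T v\<close>. The restriction keeps the values in the extensional function space
    \<open>?V\<close>.\<close>
  define T where "T v = restrict (\<lambda>j. \<Sum>i<N. g $$ (i, j) * v i) {..<N}" for v
  define F where "F = (\<Prod>j<N. (\<Sum>i<N. mconst (g $$ (i, j)) * mvar i) ^ (?q - 1) :: 'a mpoly)"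
  have corner_prod: "Poly_Mapping.single ?c 1 = (\<Prod>j<N. mvar j ^ (?q - 1) :: 'a mpoly)"
    by (simp only: prod_mvar_power corner_def)
  have lin: "lin_form n g j = (\<Sum>i<N. mconst (g $$ (i, j)) * mvar i)" if "j < N" for j
    unfolding lin_form_def
    by (rule sum.mono_neutral_right) (use \<open>N \<le> n\<close> that block in \<open>auto simp: mconst_simps not_less\<close>)
  have act_prod: "act n g (prod h A) = (\<Prod>i\<in>A. act n g (h i))" for A and h :: "nat \<Rightarrow> 'a mpoly"
    using act_mconst[of n g 1]
    by (induction A rule: infinite_finite_induct) (auto simp: act_mult mconst_simps)
  have act: "act n g (Poly_Mapping.single ?c 1) = F"
    unfolding corner_prod act_prod act_power F_def
    by (rule prod.cong) (use \<open>N \<le> n\<close> in \<open>auto simp: act_mvar lin\<close>)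
  \<comment> \<open>The degree is left as \<open>0 + 1\<close>, the shape that
    \<open>homogeneous_mult\<close> gives for a constant times a variable.\<close>
  have "(\<Sum>i<N. mconst (g $$ (i, j)) * mvar i) \<in> homogeneous N (0 + 1)" for j
    by (intro homogeneous_sum homogeneous_mult homogeneous_mconst homogeneous_mvar) auto
  then have "F \<in> homogeneous N (\<Sum>j<N. (?q - 1) * (0 + 1))"
    unfolding F_def by (intro homogeneous_prod homogeneous_power)
  then have F: "F \<in> homogeneous N (N * (?q - 1))" by simp
  have finV: "finite ?V" by (rule finite_PiE) auto
  \<comment> \<open>On a finite set surjectivity is enough, so only preimages have to be
    constructed.\<close>
  have "inj_on T ?V \<and> T ` ?V = ?V"
  proof -
    have "T v \<in> ?V" for v by (simp add: T_def restrict_PiE_iff)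
    then have "T ` ?V \<subseteq> ?V" by blast
    moreover have "?V \<subseteq> T ` ?V"
    proof
      fix u assume u: "u \<in> ?V"
      obtain B where B: "B * g = 1\<^sub>m n" "B \<in> carrier_mat n n"
      proof -
        from g have gc: "g \<in> carrier_mat n n" by (simp add: GL_def)
        from g obtain B where B: "inverts_mat g B" "inverts_mat B g"
          by (auto simp: GL_def invertible_mat_def)
        have "dim_col (g * B) = n" "dim_row B = dim_col (B * g)"
          using gc B by (auto simp: inverts_mat_def)
        then have "B \<in> carrier_mat n n" using gc by auto
        then show ?thesis using that B by (auto simp: inverts_mat_def)
      qed
      \<comment> \<open>The row vector \<open>u\<close>, padded with zeros to length
        \<open>n\<close>, is multiplied by the inverse \<open>B\<close> of \<open>g\<close>; the
        first \<open>N\<close> entries of the result give the preimage.\<close>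
      define w where "w i = (\<Sum>k<N. u k * B $$ (k, i))" for i
      have "(\<Sum>i<N. g $$ (i, j) * w i) = u j" if j: "j < N" for j
      proof -
        have "(\<Sum>i<N. g $$ (i, j) * w i) = (\<Sum>i<n. g $$ (i, j) * w i)"
          by (rule sum.mono_neutral_left) (use \<open>N \<le> n\<close> j block in \<open>auto simp: not_less\<close>)
        also have "\<dots> = (\<Sum>i<n. \<Sum>k<N. u k * (B $$ (k, i) * g $$ (i, j)))"
          by (simp add: w_def sum_distrib_left mult_ac)
        also have "\<dots> = (\<Sum>k<N. u k * (\<Sum>i<n. B $$ (k, i) * g $$ (i, j)))"
          by (subst sum.swap) (simp add: sum_distrib_left)
        also have "\<dots> = (\<Sum>k<N. u k * (B * g) $$ (k, j))"
        proof (rule sum.cong)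
          fix k assume "k \<in> {..<N}"
          then have "(B * g) $$ (k, j) = (\<Sum>i<n. B $$ (k, i) * g $$ (i, j))"
            using B(2) j g \<open>N \<le> n\<close> by (auto simp: GL_def scalar_prod_def atLeast0LessThan)
          then show "u k * (\<Sum>i<n. B $$ (k, i) * g $$ (i, j)) = u k * (B * g) $$ (k, j)" by simp
        qed simp
        also have "\<dots> = (\<Sum>k<N. if k = j then u k else 0)"
          unfolding B(1) by (rule sum.cong) (use j \<open>N \<le> n\<close> in auto)
        finally show ?thesis using j by simp
      qed
      then have "u = T (restrict w {..<N})"
        using u by (intro ext) (simp add: T_def PiE_iff extensional_def)
      moreover have "restrict w {..<N} \<in> ?V" by (simp add: restrict_PiE_iff)
      ultimately show "u \<in> T ` ?V" by (rule image_eqI)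
    qed
    ultimately show ?thesis using finV finite_surj_inj by blast
  qed
  then have T: "inj_on T ?V" "T ` ?V = ?V" by auto
  have "(-1) ^ N * Poly_Mapping.lookup F ?c = (\<Sum>v\<in>?V. eval_mpoly N v F)"
    by (rule sum_eval_mpoly[OF F, symmetric])
  also have "\<dots> = (\<Sum>v\<in>?V. eval_mpoly N (T v) (Poly_Mapping.single ?c 1))"
    by (simp add: F_def corner_prod eval_mpoly_prod eval_mpoly_power eval_mpoly_sum eval_mpoly_mult
      eval_mpoly_mconst eval_mpoly_mvar T_def)
  also have "\<dots> = (\<Sum>v\<in>T ` ?V. eval_mpoly N v (Poly_Mapping.single ?c 1))"
    using T(1) by (simp add: sum.reindex)
  also have "\<dots> = (-1) ^ N * Poly_Mapping.lookup (Poly_Mapping.single ?c (1::'a)) ?c"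
    unfolding T(2) by (rule sum_eval_mpoly) (rule corner_homogeneous, simp)
  finally have Fc: "Poly_Mapping.lookup F ?c = 1" by simp
  have "Poly_Mapping.lookup F m = Poly_Mapping.lookup (Poly_Mapping.single ?c 1) m"
    if "reduced ?q n m" for m
  proof (cases "m = ?c")
    case False
    have "m \<notin> Poly_Mapping.keys F"
    proof
      assume m: "m \<in> Poly_Mapping.keys F"
      have "\<forall>i<N. Poly_Mapping.lookup m i \<le> ?q - 1"
        using that \<open>N \<le> n\<close> unfolding reduced_def by (metis One_nat_def Suc_pred less_Suc_eq_le less_le_trans zero_less_card_finite)
      then show False using eq_cornerI[of m N ?q] m F False
        by (auto simp: homogeneous_def polys_def)
    qed
    then show ?thesis using False by (simp add: in_keys_iff lookup_single)
  qed (simp add: Fc)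
  moreover have "Poly_Mapping.single ?c 1 \<in> (polys n :: 'a mpoly set)"
    using corner_homogeneous[OF \<open>N \<le> n\<close>] by (auto simp: homogeneous_def)
  moreover have "F \<in> polys n" using act_closed act by metis
  ultimately show ?thesis unfolding act by (simp add: trunc_proj_eq_iff)
qed

section \<open>Parabolic subgroups\<close>

lemma psum_mono: "i \<le> j \<Longrightarrow> psum \<alpha> i \<le> psum \<alpha> j" for \<alpha> :: "nat list"
  by (metis le_add1 le_add_diff_inverse sum_list_append take_add)

lemma psum_strict_mono:
  assumes "\<forall>a\<in>set \<alpha>. 0 < a" "i < j" "j \<le> length \<alpha>"
  shows "psum \<alpha> i < psum \<alpha> j"
proof -
  have "psum \<alpha> (Suc i) = psum \<alpha> i + \<alpha> ! i" using assms by (simp add: take_Suc_conv_app_nth)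
  moreover have "0 < \<alpha> ! i" using assms by simp
  moreover have "psum \<alpha> (Suc i) \<le> psum \<alpha> j" using assms by (intro psum_mono) simp
  ultimately show ?thesis by simp
qed

lemma block_of_le_iff:
  assumes "i < sum_list \<alpha>"
  shows "block_of \<alpha> i \<le> k \<longleftrightarrow> i < psum \<alpha> (Suc k)"
proof
  have "i < psum \<alpha> (Suc (length \<alpha>))" using assms by simp
  then have "i < psum \<alpha> (Suc (block_of \<alpha> i))" unfolding block_of_def by (rule LeastI)
  then show "block_of \<alpha> i \<le> k \<Longrightarrow> i < psum \<alpha> (Suc k)"
    using psum_mono[of "Suc (block_of \<alpha> i)" "Suc k" \<alpha>] by simp
next
  show "i < psum \<alpha> (Suc k) \<Longrightarrow> block_of \<alpha> i \<le> k" unfolding block_of_def by (rule Least_le)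
qed

lemma block_of_down_closed:
  assumes S: "S \<subseteq> {..<sum_list \<alpha>}"
    and down: "\<And>i j. j \<in> S \<Longrightarrow> i < sum_list \<alpha> \<Longrightarrow> block_of \<alpha> i \<le> block_of \<alpha> j \<Longrightarrow> i \<in> S"
  obtains k where "k \<le> length \<alpha>" "S = {..<psum \<alpha> k}"
proof (cases "S = {}")
  case True
  then show ?thesis by (intro that[of 0]) auto
next
  case False
  define j where "j = Max S"
  have fin: "finite S" using S finite_subset by blast
  then have j: "j \<in> S" "\<And>i. i \<in> S \<Longrightarrow> i \<le> j" using False by (auto simp: j_def)
  then have jn: "j < sum_list \<alpha>" using S by auto
  let ?k = "Suc (block_of \<alpha> j)"
  have "j < psum \<alpha> ?k" using block_of_le_iff[OF jn] by blast
  then have "S \<subseteq> {..<psum \<alpha> ?k}" using j(2) by fastforce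
  moreover have "{..<psum \<alpha> ?k} \<subseteq> S"
  proof
    fix i assume i: "i \<in> {..<psum \<alpha> ?k}"
    have "psum \<alpha> ?k \<le> sum_list \<alpha>" using psum_mono[of ?k "max ?k (length \<alpha>)" \<alpha>] by simp
    with i have "i < sum_list \<alpha>" by simp
    then show "i \<in> S" using down[OF j(1)] block_of_le_iff i by blast
  qed
  moreover have "?k \<le> length \<alpha>"
  proof -
    have "0 < length \<alpha>" using jn by (cases \<alpha>) auto
    then have "block_of \<alpha> j \<le> length \<alpha> - 1" using block_of_le_iff[OF jn] jn by simp
    then show ?thesis using \<open>0 < length \<alpha>\<close> by linarith
  qed
  ultimately show ?thesis using that by blast
qed

lemma multrow_mat_parabolic:
  assumes "i < sum_list \<alpha>" "x \<noteq> (0::'a::field)"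
  shows "multrow_mat (sum_list \<alpha>) i x \<in> parabolic \<alpha>"
proof -
  let ?n = "sum_list \<alpha>"
  have "multrow_mat ?n i x * multrow_mat ?n i (inverse x) = 1\<^sub>m ?n"
    "multrow_mat ?n i (inverse x) * multrow_mat ?n i x = 1\<^sub>m ?n"
    using multrow_mat_inv[OF assms(1), of x] multrow_mat_inv[OF assms(1), of "inverse x"] assms by auto
  then have "invertible_mat (multrow_mat ?n i x)"
    unfolding invertible_mat_def inverts_mat_def by auto
  then show ?thesis by (auto simp: parabolic_def GL_def)
qed

lemma addrow_mat_parabolic:
  assumes "i < sum_list \<alpha>" "j < sum_list \<alpha>" "i \<noteq> j" "block_of \<alpha> i \<le> block_of \<alpha> j"
  shows "addrow_mat (sum_list \<alpha>) (1::'a::field) i j \<in> parabolic \<alpha>"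
proof -
  let ?n = "sum_list \<alpha>"
  have "addrow_mat ?n 1 i j * addrow_mat ?n (-1) i j = (1\<^sub>m ?n :: 'a mat)"
    "addrow_mat ?n (-1) i j * addrow_mat ?n 1 i j = (1\<^sub>m ?n :: 'a mat)"
    using addrow_mat_inv[OF assms(1,2,3), of 1] addrow_mat_inv[OF assms(1,2,3), of "-1"] by auto
  then have "invertible_mat (addrow_mat ?n (1::'a) i j)"
    unfolding invertible_mat_def inverts_mat_def by auto
  then show ?thesis using assms by (auto simp: parabolic_def GL_def)
qed

lemma mconst_power: "mconst x ^ k = mconst (x ^ k)" for x :: "'a::comm_ring_1"
  by (induction k) (auto simp: mconst_simps)

lemma lookup_act_multrow_mat:
  fixes f :: "'a::field mpoly"
  assumes f: "f \<in> polys n" and i: "i < n"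
  shows "Poly_Mapping.lookup (act n (multrow_mat n i x) f) m =
    x ^ Poly_Mapping.lookup m i * Poly_Mapping.lookup f m"
proof -
  let ?g = "multrow_mat n i x"
  have lin: "lin_form n ?g j = mconst (if j = i then x else 1) * mvar j" if "j < n" for j
  proof -
    have "lin_form n ?g j = (\<Sum>k<n. if k = j then mconst (if j = i then x else 1) * mvar j else 0)"
      unfolding lin_form_def using that by (intro sum.cong) (auto simp: mconst_simps)
    then show ?thesis using that by simp
  qed
  have mono: "(\<Prod>j<n. lin_form n ?g j ^ Poly_Mapping.lookup m' j) =
      Poly_Mapping.single m' (x ^ Poly_Mapping.lookup m' i)"
    if "m' \<in> Poly_Mapping.keys f" for m'
  proof -
    have "(\<Prod>j<n. lin_form n ?g j ^ Poly_Mapping.lookup m' j) =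
        (\<Prod>j<n. mconst (if j = i then x else 1) ^ Poly_Mapping.lookup m' j) *
        (\<Prod>j<n. mvar j ^ Poly_Mapping.lookup m' j)"
      by (simp add: lin power_mult_distrib prod.distrib)
    also have "(\<Prod>j<n. mconst (if j = i then x else 1) ^ Poly_Mapping.lookup m' j) =
        (\<Prod>j<n. if j = i then mconst x ^ Poly_Mapping.lookup m' j else 1)"
      by (rule prod.cong) (auto simp: mconst_simps)
    also have "\<dots> = mconst x ^ Poly_Mapping.lookup m' i" using i by simp
    also have "\<dots> = mconst (x ^ Poly_Mapping.lookup m' i)"
      by (rule mconst_power)
    also have "(\<Prod>j<n. mvar j ^ Poly_Mapping.lookup m' j) = (Poly_Mapping.single m' 1 :: 'a mpoly)"
      using f that by (intro mono_eq_prod_mvar) (auto simp: polys_def)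
    finally show ?thesis by (simp add: mconst_def mult_single)
  qed
  have "Poly_Mapping.lookup (act n ?g f) m = (\<Sum>m'\<in>Poly_Mapping.keys f. Poly_Mapping.lookup f m' *
      Poly_Mapping.lookup (Poly_Mapping.single m' (x ^ Poly_Mapping.lookup m' i)) m)"
    unfolding lookup_act by (rule sum.cong) (simp_all add: mono)
  also have "\<dots> = (\<Sum>m'\<in>Poly_Mapping.keys f. if m' = m then
      Poly_Mapping.lookup f m * x ^ Poly_Mapping.lookup m i else 0)"
    by (rule sum.cong) (auto simp: lookup_single)
  finally show ?thesis by (simp add: in_keys_iff)
qed

lemma power_add_eq: "\<exists>h. (a + b) ^ k = b ^ k + a * h" for a b :: "'a::comm_ring_1"
proof (induction k)
  case (Suc k)
  then obtain h where "(a + b) ^ k = b ^ k + a * h" by blast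
  then have "(a + b) ^ Suc k = b ^ Suc k + a * (b ^ k + (a + b) * h)" by (simp add: algebra_simps)
  then show ?case by blast
qed (auto intro: exI[of _ 0])

text \<open>Setting \<open>x\<^sub>j = 0\<close> after the transvection \<open>x\<^sub>j \<mapsto> x\<^sub>j + x\<^sub>i\<close> amounts to replacing \<open>x\<^sub>j\<close> by \<open>x\<^sub>i\<close>.\<close>

lemma lookup_act_addrow_mat:
  fixes f :: "'a::field mpoly"
  assumes f: "f \<in> polys n" and ij: "i < n" "j < n" "i \<noteq> j" and M: "Poly_Mapping.lookup M j = 0"
  shows "Poly_Mapping.lookup (act n (addrow_mat n 1 i j) f) M =
    (\<Sum>m\<in>{m\<in>Poly_Mapping.keys f. \<forall>k. Poly_Mapping.lookup M k =
        (if k = j then 0 else if k = i then Poly_Mapping.lookup m i + Poly_Mapping.lookup m j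
         else Poly_Mapping.lookup m k)}. Poly_Mapping.lookup f m)"
proof -
  let ?g = "addrow_mat n (1::'a) i j"
  have lin: "lin_form n ?g k = (if k = j then mvar j + mvar i else mvar k)" if "k < n" for k
  proof -
    have "lin_form n ?g k = (\<Sum>l<n. (if l = k then mvar k else 0) +
        (if l = i then (if k = j then mvar i else 0) else 0))"
      unfolding lin_form_def using that ij by (intro sum.cong) (auto simp: mconst_simps)
    then show ?thesis using that ij by (simp add: sum.distrib)
  qed
  define e where "e m k = (if k = j then 0 else if k = i then
    Poly_Mapping.lookup m i + Poly_Mapping.lookup m j else Poly_Mapping.lookup m k)" for m :: "nat \<Rightarrow>\<^sub>0 nat" and k
  define E where "E m = (\<Sum>k<n. Poly_Mapping.single k (e m k))" for m
  have mono: "Poly_Mapping.lookup (\<Prod>k<n. lin_form n ?g k ^ Poly_Mapping.lookup m k) M =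
      (if E m = M then 1 else 0)" if m: "m \<in> Poly_Mapping.keys f" for m
  proof -
    let ?l = "Poly_Mapping.lookup m"
    obtain h where h: "(mvar j + mvar i) ^ ?l j = (mvar i ^ ?l j + mvar j * h :: 'a mpoly)"
      using power_add_eq by blast
    have rest: "(\<Prod>k<n. F k) = F j * (\<Prod>k\<in>{..<n}-{j}. F k)" for F :: "nat \<Rightarrow> 'a mpoly"
      by (rule prod.remove) (use ij in auto)
    let ?P = "\<Prod>k\<in>{..<n}-{j}. mvar k ^ ?l k :: 'a mpoly"
    have "(\<Prod>k<n. lin_form n ?g k ^ ?l k) = (mvar j + mvar i) ^ ?l j * ?P"
      unfolding rest using ij by (auto intro!: arg_cong2[where f="(*)"] prod.cong simp: lin)
    also have "\<dots> = mvar i ^ ?l j * ?P + mvar j * (h * ?P)"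
      unfolding h by (simp add: algebra_simps)
    also have "mvar i ^ ?l j * ?P = (\<Prod>k<n. mvar k ^ e m k)"
    proof -
      have rest': "(\<Prod>k\<in>{..<n}-{j}. F k) = F i * (\<Prod>k\<in>{..<n}-{j}-{i}. F k)" for F :: "nat \<Rightarrow> 'a mpoly"
        by (rule prod.remove) (use ij in auto)
      have "(\<Prod>k\<in>{..<n}-{j}-{i}. mvar k ^ e m k) = (\<Prod>k\<in>{..<n}-{j}-{i}. mvar k ^ ?l k :: 'a mpoly)"
        by (rule prod.cong) (auto simp: e_def)
      then show ?thesis unfolding rest rest' using ij by (simp add: e_def power_add)
    qed
    also have "\<dots> = Poly_Mapping.single (E m) 1" by (simp add: prod_mvar_power E_def)
    finally show ?thesis using lookup_mvar_mult_eq_0[OF M]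
      by (simp add: lookup_add lookup_single when_def)
  qed
  have E: "E m = M \<longleftrightarrow> (\<forall>k. Poly_Mapping.lookup M k = e m k)" if "m \<in> Poly_Mapping.keys f" for m
  proof -
    have "Poly_Mapping.lookup m k = 0" if "\<not> k < n" for k
      using f \<open>m \<in> _\<close> that unfolding polys_def by (auto simp flip: not_in_keys_iff_lookup_eq_zero)
    then have "Poly_Mapping.lookup (E m) k = e m k" for k
      using ij by (auto simp: E_def lookup_sum_single e_def)
    then show ?thesis by (metis poly_mapping_eqI)
  qed
  have "Poly_Mapping.lookup (act n ?g f) M =
      (\<Sum>m\<in>Poly_Mapping.keys f. if \<forall>k. Poly_Mapping.lookup M k = e m k then Poly_Mapping.lookup f m else 0)"
    unfolding lookup_act by (rule sum.cong) (auto simp: mono E)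
  then show ?thesis by (simp add: sum.inter_filter e_def)
qed

section \<open>The fixed subalgebra\<close>

definition corner_class :: "nat \<Rightarrow> nat \<Rightarrow> 'a::finite_field \<Rightarrow> 'a mpoly set" where
  "corner_class n N c = trunc_proj n (Poly_Mapping.single (corner CARD('a) N) c)"

lemma fixed_keys:
  fixes f :: "'a::finite_field mpoly"
  assumes \<alpha>: "sum_list \<alpha> = n" and f: "f \<in> polys n" "\<forall>m\<in>Poly_Mapping.keys f. reduced CARD('a) n m"
    and fixed: "\<And>g. g \<in> parabolic \<alpha> \<Longrightarrow> trunc_proj n (act n g f) = trunc_proj n f"
    and m: "m \<in> Poly_Mapping.keys f"
  shows "\<exists>k\<le>length \<alpha>. m = corner CARD('a) (psum \<alpha> k)"
proof -
  let ?q = "CARD('a)"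
  have q: "?q \<ge> 2" by (rule card_finite_field_ge_2)
  have coeff: "Poly_Mapping.lookup (act n g f) m' = Poly_Mapping.lookup f m'"
    if "g \<in> parabolic \<alpha>" "reduced ?q n m'" for g m'
    using fixed[OF that(1)] that(2) f(1) by (simp add: trunc_proj_eq_iff act_closed)
  have exps: "Poly_Mapping.lookup m' i \<in> {0, ?q - 1}" if "m' \<in> Poly_Mapping.keys f" for m' i
  proof (cases "i < n")
    case True
    show ?thesis
    proof (rule ccontr)
      assume "\<not> ?thesis"
      moreover have "Poly_Mapping.lookup m' i < ?q" using f(2) that True by (auto simp: reduced_def)
      ultimately obtain x :: 'a where x: "x \<noteq> 0" "x ^ Poly_Mapping.lookup m' i \<noteq> 1"
        using ex_power_neq_1[of "Poly_Mapping.lookup m' i", where 'a='a] by fastforce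
      have "Poly_Mapping.lookup (act n (multrow_mat n i x) f) m' = Poly_Mapping.lookup f m'"
        using coeff multrow_mat_parabolic[of i \<alpha> x] True \<alpha> x f(2) that by auto
      then show False
        using x that by (simp add: lookup_act_multrow_mat[OF f(1) True] in_keys_iff)
    qed
  next
    case False
    have "i \<notin> Poly_Mapping.keys m'" using f(1) that False by (auto simp: polys_def)
    then show ?thesis by (simp add: in_keys_iff)
  qed
  define S where "S = Poly_Mapping.keys m"
  have full: "Poly_Mapping.lookup m i = (if i \<in> S then ?q - 1 else 0)" for i
    using exps[OF m, of i] by (auto simp: S_def in_keys_iff)
  have S: "S \<subseteq> {..<sum_list \<alpha>}" using f(1) m \<alpha> by (auto simp: S_def polys_def)
  have "i \<in> S" if j: "j \<in> S" and i: "i < sum_list \<alpha>" and le: "block_of \<alpha> i \<le> block_of \<alpha> j" for i j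
  proof (rule ccontr)
    assume iS: "i \<notin> S"
    have j': "j < n" using j S \<alpha> by auto
    have ij: "i \<noteq> j" using iS j by auto
    define M where "M = (\<Sum>k\<in>insert i (S - {j}). Poly_Mapping.single k (?q - 1))"
    have finS: "finite S" by (simp add: S_def)
    have M: "Poly_Mapping.lookup M k = (if k = i \<or> k \<in> S \<and> k \<noteq> j then ?q - 1 else 0)" for k
      unfolding M_def using finS by (subst lookup_sum_single) auto
    define e where "e m' k = (if k = j then 0 else if k = i then
      Poly_Mapping.lookup m' i + Poly_Mapping.lookup m' j else Poly_Mapping.lookup m' k)" for m' :: "nat \<Rightarrow>\<^sub>0 nat" and k
    have "m' = m \<or> m' = M" if m': "m' \<in> Poly_Mapping.keys f" "\<forall>k. Poly_Mapping.lookup M k = e m' k" for m'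
    proof -
      have sum: "Poly_Mapping.lookup m' i + Poly_Mapping.lookup m' j = ?q - 1"
        using m'(2)[rule_format, of i] ij by (simp add: e_def M)
      have oth: "Poly_Mapping.lookup m' k = (if k \<in> S then ?q - 1 else 0)" if "k \<noteq> i" "k \<noteq> j" for k
        using m'(2)[rule_format, of k] that by (simp add: e_def M)
      consider "Poly_Mapping.lookup m' j = 0" | "Poly_Mapping.lookup m' j = ?q - 1"
        using exps[OF m'(1), of j] by auto
      then show ?thesis
      proof cases
        case 1
        then have "Poly_Mapping.lookup m' k = Poly_Mapping.lookup M k" for k
          using sum oth[of k] ij by (cases "k = i"; cases "k = j") (auto simp: M)
        then show ?thesis using poly_mapping_eqI by blast
      next
        case 2
        moreover have "Poly_Mapping.lookup m' i = 0" using sum 2 by linarith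
        ultimately have "Poly_Mapping.lookup m' k = Poly_Mapping.lookup m k" for k
          using oth[of k] ij iS j by (cases "k = i"; cases "k = j") (auto simp: full)
        then show ?thesis using poly_mapping_eqI by blast
      qed
    qed
    moreover have "\<forall>k. Poly_Mapping.lookup M k = e m k" "\<forall>k. Poly_Mapping.lookup M k = e M k"
      using ij iS j by (auto simp: M e_def full)
    ultimately have "{m'\<in>Poly_Mapping.keys f. \<forall>k. Poly_Mapping.lookup M k = e m' k} =
        {m} \<union> ({M} \<inter> Poly_Mapping.keys f)"
      using m by blast
    moreover have "m \<noteq> M"
    proof
      assume "m = M"
      then have "Poly_Mapping.lookup m i = Poly_Mapping.lookup M i" by simp
      then show False using q iS by (simp add: M full)
    qed
    ultimately have "Poly_Mapping.lookup (act n (addrow_mat n 1 i j) f) M =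
        Poly_Mapping.lookup f m + Poly_Mapping.lookup f M"
      using lookup_act_addrow_mat[OF f(1), of i j M] i j' ij \<alpha>
      by (cases "M \<in> Poly_Mapping.keys f") (auto simp: M e_def in_keys_iff)
    moreover have "Poly_Mapping.lookup (act n (addrow_mat n 1 i j) f) M = Poly_Mapping.lookup f M"
      using addrow_mat_parabolic[OF i _ ij le, where 'a='a] j' \<alpha> q
      by (intro coeff) (auto simp: reduced_def M)
    ultimately show False using m by (simp add: in_keys_iff)
  qed
  then obtain k where k: "k \<le> length \<alpha>" "S = {..<psum \<alpha> k}"
    using block_of_down_closed[OF S] by blast
  have "m = corner ?q (psum \<alpha> k)"
    by (rule poly_mapping_eqI) (simp add: full k lookup_corner)
  with k show ?thesis by blast
qed

lemma corner_class_fixed: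
  assumes "sum_list \<alpha> = n" "g \<in> parabolic \<alpha>"
  shows "trunc_act n g (corner_class n (psum \<alpha> k) c) = corner_class n (psum \<alpha> k) (c::'a::finite_field)"
proof -
  let ?N = "psum \<alpha> k"
  let ?s = "Poly_Mapping.single (corner CARD('a) ?N)"
  have le: "?N \<le> n" using assms psum_mono[of k "max k (length \<alpha>)" \<alpha>] by simp
  have g: "g \<in> GL n" using assms by (simp add: parabolic_def)
  have "g $$ (i, j) = 0" if ij: "?N \<le> i" "i < n" "j < ?N" for i j
  proof (cases k)
    case (Suc k')
    have "block_of \<alpha> j \<le> k'" "\<not> block_of \<alpha> i \<le> k'"
      using block_of_le_iff[of _ \<alpha> k'] ij le assms Suc by auto
    then show ?thesis using assms ij le by (auto simp: parabolic_def)
  qed (use ij in simp)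
  from act_corner[OF le g this]
  have "trunc_proj n (act n g (?s 1)) = trunc_proj n (?s 1)" .
  moreover have sc: "?s c = mconst c * ?s 1" by (simp add: mconst_def mult_single)
  moreover have p: "?s x \<in> polys n" for x :: 'a
    using corner_homogeneous[OF le, of "CARD('a)" x] by (simp add: homogeneous_def)
  ultimately have "trunc_proj n (act n g (?s c)) = trunc_proj n (?s c)"
    using p[of c] p[of 1] unfolding sc
    by (simp add: trunc_proj_eq_iff act_closed polys_closed act_mult act_mconst lookup_mconst_mult)
  then show ?thesis using p by (simp add: corner_class_def trunc_act_proj)
qed

lemma trunc_ring_hom:
  "ring_hom_ring (poly_ring n) (trunc_ring n :: 'a::finite_field mpoly set ring) (trunc_proj n)"
proof -
  interpret cring "poly_ring n :: 'a mpoly ring" by (rule cring_poly_ring)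
  interpret I: ideal "frob_ideal n :: 'a mpoly set" "poly_ring n" by (rule frob_ideal_ideal)
  show ?thesis
    using I.rcos_ring_hom_ring by (simp add: trunc_ring_def trunc_proj_def[abs_def])
qed

lemma psum_inject:
  assumes "\<forall>a\<in>set \<alpha>. 0 < a" "k \<le> length \<alpha>" "k' \<le> length \<alpha>"
  shows "psum \<alpha> k = psum \<alpha> k' \<longleftrightarrow> k = k'"
  using psum_strict_mono[OF assms(1), of k k'] psum_strict_mono[OF assms(1), of k' k] assms
  by (metis less_irrefl linorder_neqE_nat)

lemma trunc_fixed_component:
  assumes \<alpha>: "is_composition n \<alpha>"
  shows "trunc_fixed n (parabolic \<alpha> :: 'a::finite_field mat set) \<inter> trunc_component n d =
    insert \<zero>\<^bsub>trunc_ring n :: 'a mpoly set ring\<^esub>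
      {corner_class n (psum \<alpha> k) c | k c. k \<le> length \<alpha> \<and> psum \<alpha> k * (CARD('a) - 1) = d}"
    (is "?L = ?R")
proof
  interpret h: ring_hom_ring "poly_ring n :: 'a mpoly ring" "trunc_ring n" "trunc_proj n"
    by (rule trunc_ring_hom)
  let ?q = "CARD('a)"
  have sum: "sum_list \<alpha> = n" and pos: "\<forall>a\<in>set \<alpha>. 0 < a"
    using \<alpha> by (simp_all add: is_composition_def)
  have le: "psum \<alpha> k \<le> n" for k using sum psum_mono[of k "max k (length \<alpha>)" \<alpha>] by simp
  have zero: "\<zero>\<^bsub>trunc_ring n\<^esub> = trunc_proj n (0 :: 'a mpoly)"
    using h.hom_zero by (simp add: poly_ring_simps)
  show "?L \<subseteq> ?R"
  proof
    fix X assume X: "X \<in> ?L"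
    then obtain f' where f': "f' \<in> homogeneous n d" "X = trunc_proj n f'"
      by (auto simp: trunc_component_def)
    obtain f where f: "f \<in> homogeneous n d" "\<forall>m\<in>Poly_Mapping.keys f. reduced ?q n m"
      "\<forall>m. reduced ?q n m \<longrightarrow> Poly_Mapping.lookup f m = Poly_Mapping.lookup f' m"
      using reduced_representative[OF f'(1)] by blast
    have fp: "f \<in> polys n" "f' \<in> polys n" using f(1) f'(1) by (auto simp: homogeneous_def)
    have Xf: "X = trunc_proj n f" using f(3) fp f'(2) by (simp add: trunc_proj_eq_iff)
    have "trunc_proj n (act n g f) = trunc_proj n f" if "g \<in> parabolic \<alpha>" for g
    proof -
      have "trunc_act n g X = X" using X that by (auto simp: trunc_fixed_def)
      then show ?thesis unfolding Xf by (simp add: trunc_act_proj[OF fp(1)])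
    qed
    then have keys: "\<exists>k\<le>length \<alpha>. m = corner ?q (psum \<alpha> k)" if "m \<in> Poly_Mapping.keys f" for m
      using fixed_keys[OF sum fp(1) f(2)] that by blast
    have deg: "psum \<alpha> k * (?q - 1) = d" if "corner ?q (psum \<alpha> k) \<in> Poly_Mapping.keys f" for k
      using f(1) that corner_homogeneous[OF le[of k], of ?q "1::'a"] by (auto simp: homogeneous_def)
    show "X \<in> ?R"
    proof (cases "f = 0")
      case True
      then show ?thesis using Xf zero by simp
    next
      case False
      then obtain m where m: "m \<in> Poly_Mapping.keys f" by (metis all_not_in_conv keys_eq_empty)
      with keys obtain k where k: "k \<le> length \<alpha>" "m = corner ?q (psum \<alpha> k)" by blast
      have "m' = m" if m': "m' \<in> Poly_Mapping.keys f" for m'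
      proof -
        obtain k' where k': "k' \<le> length \<alpha>" "m' = corner ?q (psum \<alpha> k')" using keys m' by blast
        have "psum \<alpha> k' * (?q - 1) = psum \<alpha> k * (?q - 1)"
          using deg[of k] deg[of k'] m m' k k' by simp
        then have "k' = k" using psum_inject[OF pos k'(1) k(1)] card_finite_field_ge_2[where 'a='a] by simp
        then show ?thesis using k k' by simp
      qed
      then have "f = Poly_Mapping.single m (Poly_Mapping.lookup f m)"
        by (intro poly_mapping_eqI) (auto simp: lookup_single when_def in_keys_iff)
      then have "X = corner_class n (psum \<alpha> k) (Poly_Mapping.lookup f m)"
        unfolding corner_class_def Xf using k(2) by simp
      then show ?thesis using k m deg by auto
    qed
  qed
  show "?R \<subseteq> ?L"
  proof
    fix X assume "X \<in> ?R"
    then consider "X = \<zero>\<^bsub>trunc_ring n\<^esub>" |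
      (c) k c where "X = corner_class n (psum \<alpha> k) c" "k \<le> length \<alpha>" "psum \<alpha> k * (?q - 1) = d"
      by blast
    then show "X \<in> ?L"
    proof cases
      case 1
      have "(0 :: 'a mpoly) \<in> homogeneous n d" by (simp add: homogeneous_def polys_closed)
      moreover have "trunc_act n g X = X" for g
        unfolding 1 zero by (simp add: trunc_act_proj polys_closed act_0)
      moreover have "X \<in> carrier (trunc_ring n)" unfolding 1 by (rule h.S.zero_closed)
      ultimately show ?thesis using 1 zero by (auto simp: trunc_fixed_def trunc_component_def)
    next
      case c
      have hom: "Poly_Mapping.single (corner ?q (psum \<alpha> k)) c \<in> homogeneous n d"
        using corner_homogeneous[OF le[of k], of ?q c] c(3) by simp
      then have "X \<in> carrier (trunc_ring n)"
        unfolding c(1) corner_class_def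
        by (intro h.hom_closed) (simp add: homogeneous_def poly_ring_simps)
      moreover have "X \<in> trunc_component n d"
        using hom unfolding c(1) corner_class_def trunc_component_def by blast
      ultimately show ?thesis
        using corner_class_fixed[OF sum] c(1) by (auto simp: trunc_fixed_def)
    qed
  qed
qed

lemma dim_trunc_fixed_component:
  assumes \<alpha>: "is_composition n \<alpha>"
  shows "ring.dim (trunc_ring n) (trunc_scalars n)
      (trunc_fixed n (parabolic \<alpha> :: 'a::finite_field mat set) \<inter> trunc_component n d) =
    card {k. k \<le> length \<alpha> \<and> psum \<alpha> k * (CARD('a) - 1) = d}"
proof -
  interpret h: ring_hom_ring "poly_ring n :: 'a mpoly ring" "trunc_ring n" "trunc_proj n"
    by (rule trunc_ring_hom)
  let ?q = "CARD('a)" and ?K = "trunc_scalars n :: 'a mpoly set set"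
  let ?E = "trunc_fixed n (parabolic \<alpha> :: 'a mat set) \<inter> trunc_component n d"
  let ?A = "{k. k \<le> length \<alpha> \<and> psum \<alpha> k * (?q - 1) = d}"
  have sum: "sum_list \<alpha> = n" and pos: "\<forall>a\<in>set \<alpha>. 0 < a"
    using \<alpha> by (simp_all add: is_composition_def)
  have le: "psum \<alpha> k \<le> n" for k using sum psum_mono[of k "max k (length \<alpha>)" \<alpha>] by simp
  have dimI: "h.S.dim ?K ?E = r" if "h.S.dimension r ?K ?E" for r
    unfolding h.S.dim_def
    using that h.S.dimension_is_inj[OF subfield_trunc_scalars] by blast
  show ?thesis
  proof (cases "?A = {}")
    case True
    then have "?E = {\<zero>\<^bsub>trunc_ring n\<^esub>}" unfolding trunc_fixed_component[OF \<alpha>] by auto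
    then show ?thesis using True dimI[of 0] by simp
  next
    case False
    then obtain k where k: "k \<le> length \<alpha>" "psum \<alpha> k * (?q - 1) = d" by blast
    have uniq: "k' = k" if "k' \<in> ?A" for k'
    proof -
      have "psum \<alpha> k' * (?q - 1) = psum \<alpha> k * (?q - 1)" "k' \<le> length \<alpha>" using that k by simp_all
      then show ?thesis using psum_inject[OF pos _ k(1)] card_finite_field_ge_2[where 'a='a] by simp
    qed
    then have A: "?A = {k}" using k by blast
    let ?s = "Poly_Mapping.single (corner ?q (psum \<alpha> k)) :: 'a \<Rightarrow> 'a mpoly"
    let ?v = "corner_class n (psum \<alpha> k) :: 'a \<Rightarrow> 'a mpoly set"
    have p: "?s c \<in> polys n" for c
      using corner_homogeneous[OF le[of k], of ?q c] by (simp add: homogeneous_def)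
    have zero: "\<zero>\<^bsub>trunc_ring n\<^esub> = trunc_proj n (0 :: 'a mpoly)"
      using h.hom_zero by (simp add: poly_ring_simps)
    have carr: "?v c \<in> carrier (trunc_ring n)" for c
      unfolding corner_class_def using p by (intro h.hom_closed) (simp add: poly_ring_simps)
    have smult: "trunc_proj n (mconst c) \<otimes>\<^bsub>trunc_ring n\<^esub> ?v 1 = ?v c" for c
    proof -
      have "mconst c * ?s 1 = ?s c" by (simp add: mconst_def mult_single)
      then show ?thesis using h.hom_mult[of "mconst c" "?s 1"] p[of 1]
        by (simp add: corner_class_def poly_ring_simps polys_closed)
    qed
    have "reduced ?q n (corner ?q (psum \<alpha> k))"
      using card_finite_field_ge_2[where 'a='a] by (auto simp: reduced_def lookup_corner)
    then have nz: "?v 1 \<notin> {\<zero>\<^bsub>trunc_ring n\<^esub>}"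
      unfolding zero corner_class_def using p by (auto simp: trunc_proj_eq_iff polys_closed)
    have "?E = insert \<zero>\<^bsub>trunc_ring n\<^esub> (range ?v)"
      unfolding trunc_fixed_component[OF \<alpha>] using A by (intro arg_cong2[where f=insert] refl) auto
    also have "\<dots> = range ?v"
    proof -
      have "?v 0 = \<zero>\<^bsub>trunc_ring n\<^esub>" by (simp add: corner_class_def zero)
      then show ?thesis by (metis insert_absorb rangeI)
    qed
    also have "\<dots> = h.S.line_extension ?K (?v 1) {\<zero>\<^bsub>trunc_ring n\<^esub>}"
      by (rule Set.set_eqI) (auto simp: h.S.line_extension_mem_iff trunc_scalars_def smult carr)
    finally have "h.S.dimension 1 ?K ?E"
      using h.S.dimension.Suc_dim[OF carr nz h.S.dimension.zero_dim, of ?K] by simp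
    then show ?thesis using dimI A by simp
  qed
qed

section \<open>The explicit series\<close>

lemma weak_comps_below_1:
  assumes "\<forall>a\<in>set \<alpha>. 0 < a"
  shows "weak_comps_below \<alpha> 1 = insert (replicate (length \<alpha>) 0)
    ((\<lambda>k. (replicate (length \<alpha>) 0)[k := 1]) ` {..<length \<alpha>})" (is "_ = ?R")
proof
  let ?z = "replicate (length \<alpha>) (0::nat)"
  show "weak_comps_below \<alpha> 1 \<subseteq> ?R"
  proof
    fix \<beta> assume "\<beta> \<in> weak_comps_below \<alpha> 1"
    then have \<beta>: "length \<beta> = length \<alpha>" "sum_list \<beta> \<le> 1" by (auto simp: weak_comps_below_def)
    show "\<beta> \<in> ?R"
    proof (cases "\<exists>k<length \<alpha>. \<beta> ! k \<noteq> 0")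
      case True
      then obtain k where k: "k < length \<alpha>" "\<beta> ! k \<noteq> 0" by blast
      have sum: "(\<Sum>i<length \<alpha>. \<beta> ! i) \<le> 1"
        using \<beta> by (simp add: sum_list_sum_nth atLeast0LessThan)
      have "\<beta> ! i = (if i = k then 1 else 0)" if "i < length \<alpha>" for i
      proof (cases "i = k")
        case True
        have "\<beta> ! k \<le> (\<Sum>i<length \<alpha>. \<beta> ! i)" using k by (intro member_le_sum) auto
        then show ?thesis using True k sum by simp
      next
        case False
        have "(\<Sum>i\<in>{i, k}. \<beta> ! i) \<le> (\<Sum>i<length \<alpha>. \<beta> ! i)"
          using k that by (intro sum_mono2) auto
        then show ?thesis using False k sum by simp
      qed
      then have "\<beta> = ?z[k := 1]"
        using \<beta>(1) by (intro nth_equalityI) (auto simp: nth_list_update)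
      then show ?thesis using k by blast
    next
      case False
      then have "\<beta> = ?z" using \<beta>(1) by (intro nth_equalityI) auto
      then show ?thesis by blast
    qed
  qed
  have "\<alpha> ! i \<ge> Suc 0" if "i < length \<alpha>" for i using assms that by (simp add: Suc_leI)
  then show "?R \<subseteq> weak_comps_below \<alpha> 1"
    by (auto simp: weak_comps_below_def sum_list_update nth_list_update sum_list_replicate)
qed

lemma Cser_1:
  assumes \<alpha>: "is_composition n \<alpha>" and q: "2 \<le> q"
  shows "Cser q \<alpha> 1 = (\<Sum>k\<le>length \<alpha>. fps_X ^ (psum \<alpha> k * (q - 1)))"
proof -
  let ?l = "length \<alpha>"
  let ?z = "replicate ?l (0::nat)"
  define t :: "nat list \<Rightarrow> rat fps" where "t \<beta> = fps_X ^ (\<Sum>i<length \<alpha>. (\<alpha> ! i - \<beta> ! i) * (q ^ 1 - q ^ psum \<beta> (Suc i))) *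
     ((\<Prod>j<sum_list \<beta>. 1 - fps_X ^ (q ^ 1 - q ^ j)) /
      (\<Prod>i<length \<alpha>. \<Prod>j<\<beta> ! i. 1 - fps_X ^ (q ^ psum \<beta> (Suc i) - q ^ (psum \<beta> i + j))))" for \<beta>
  have pos: "\<forall>a\<in>set \<alpha>. 0 < a" using \<alpha> by (simp add: is_composition_def)
  have psum_nth: "(\<Sum>i<k. \<alpha> ! i) = psum \<alpha> k" if "k \<le> ?l" for k
    using that by (simp add: sum_list_sum_nth atLeast0LessThan)
  have tz: "t ?z = fps_X ^ (psum \<alpha> ?l * (q - 1))"
  proof -
    have "(\<Sum>i<?l. (\<alpha> ! i - ?z ! i) * (q ^ 1 - q ^ psum ?z (Suc i))) = psum \<alpha> ?l * (q - 1)"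
      unfolding psum_nth[OF order.refl, symmetric] sum_distrib_right
      by (rule sum.cong) (auto simp: sum_list_replicate)
    then show ?thesis unfolding t_def by (simp add: sum_list_replicate)
  qed
  have te: "t (?z[k := 1]) = fps_X ^ (psum \<alpha> k * (q - 1))" if k: "k < ?l" for k
  proof -
    define e where "e = ?z[k := 1]"
    have nth: "e ! i = (if i = k then 1 else 0)" if "i < ?l" for i
      using that by (simp add: e_def nth_list_update)
    have ps: "psum e i = (if k < i then 1 else 0)" if "i \<le> ?l" for i
    proof -
      have "psum e i = (\<Sum>j<i. if j = k then 1 else 0)"
        unfolding sum_list_sum_nth atLeast0LessThan
        by (rule sum.cong) (use that in \<open>auto simp: e_def nth_list_update\<close>)
      then show ?thesis by simp
    qed
    have "(\<Sum>i<?l. (\<alpha> ! i - e ! i) * (q ^ 1 - q ^ psum e (Suc i))) = (\<Sum>i<?l. if i < k then \<alpha> ! i * (q - 1) else 0)"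
      by (rule sum.cong) (auto simp: ps nth)
    also have "\<dots> = (\<Sum>i<k. \<alpha> ! i * (q - 1))"
      using k by (intro sum.mono_neutral_cong_right) auto
    also have "\<dots> = psum \<alpha> k * (q - 1)" using k by (simp add: psum_nth flip: sum_distrib_right)
    finally have expo: "(\<Sum>i<?l. (\<alpha> ! i - e ! i) * (q ^ 1 - q ^ psum e (Suc i))) = psum \<alpha> k * (q - 1)" .
    have sl: "sum_list e = 1" using k by (simp add: e_def sum_list_update sum_list_replicate)
    have "(\<Prod>i<?l. \<Prod>j<e ! i. 1 - fps_X ^ (q ^ psum e (Suc i) - q ^ (psum e i + j))) =
        (\<Prod>i<?l. if i = k then 1 - fps_X ^ (q - 1) else (1 :: rat fps))"
      using k by (intro prod.cong) (auto simp: ps nth)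
    also have "\<dots> = 1 - fps_X ^ (q - 1)" using k by simp
    finally have den: "(\<Prod>i<?l. \<Prod>j<e ! i. 1 - fps_X ^ (q ^ psum e (Suc i) - q ^ (psum e i + j))) =
        (1 - fps_X ^ (q - 1) :: rat fps)" .
    have "fps_nth (1 - fps_X ^ (q - 1) :: rat fps) 0 = 1" using q by (simp add: fps_X_power_nth)
    then have nz: "(1 - fps_X ^ (q - 1) :: rat fps) \<noteq> 0" by (metis fps_zero_nth zero_neq_one)
    show ?thesis unfolding t_def e_def[symmetric] expo den sl using nz by simp
  qed
  have inj: "inj_on (\<lambda>k. ?z[k := 1]) {..<?l}"
  proof (rule inj_onI)
    fix x y assume "x \<in> {..<?l}" "y \<in> {..<?l}" "?z[x := 1] = ?z[y := 1]"
    then have "?z[x := 1] ! x = ?z[y := 1] ! x" "x < ?l" by auto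
    then show "x = y" by (cases "x = y") simp_all
  qed
  have notin: "?z \<notin> (\<lambda>k. ?z[k := 1]) ` {..<?l}"
  proof
    assume "?z \<in> (\<lambda>k. ?z[k := 1]) ` {..<?l}"
    then obtain k where "k < ?l" "?z = ?z[k := 1]" by blast
    then have "?z ! k = ?z[k := 1] ! k" by simp
    then show False using \<open>k < ?l\<close> by simp
  qed
  have "Cser q \<alpha> 1 = (\<Sum>\<beta>\<in>weak_comps_below \<alpha> 1. t \<beta>)" by (simp add: Cser_def t_def)
  also have "\<dots> = t ?z + (\<Sum>k<?l. t (?z[k := 1]))"
    unfolding weak_comps_below_1[OF pos] using notin sum.reindex[OF inj, of t] by (simp add: comp_def)
  also have "\<dots> = fps_X ^ (psum \<alpha> ?l * (q - 1)) + (\<Sum>k<?l. fps_X ^ (psum \<alpha> k * (q - 1)))"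
    using te tz by simp
  also have "\<dots> = (\<Sum>k\<le>?l. fps_X ^ (psum \<alpha> k * (q - 1)))"
    by (simp add: lessThan_Suc_atMost[symmetric] add.commute)
  finally show ?thesis .
qed

theorem proposition4p1:
  fixes q n :: nat and \<alpha> :: "nat list"
  assumes "q = CARD('a::finite_field)"
    and "n \<ge> 1"
    and "is_composition n \<alpha>"
  shows "trunc_hilb n (trunc_fixed n (parabolic \<alpha> :: 'a mat set)) = Cser q \<alpha> 1"
proof (rule fps_ext)
  fix d
  have "2 \<le> q" using card_finite_field_ge_2 assms(1) by blast
  then have "fps_nth (Cser q \<alpha> 1) d = (\<Sum>k\<le>length \<alpha>. if psum \<alpha> k * (q - 1) = d then 1 else 0)"
    unfolding Cser_1[OF assms(3) \<open>2 \<le> q\<close>] by (auto simp: fps_sum_nth fps_X_power_nth intro!: sum.cong)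
  also have "\<dots> = of_nat (card {k. k \<le> length \<alpha> \<and> psum \<alpha> k * (q - 1) = d})"
    by (simp add: sum.If_cases Int_def)
  finally show "fps_nth (trunc_hilb n (trunc_fixed n (parabolic \<alpha> :: 'a mat set))) d = fps_nth (Cser q \<alpha> 1) d"
    by (simp add: trunc_hilb_def dim_trunc_fixed_component[OF assms(3)] assms(1))
qed

end
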